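(* Let $G$ be a group with identity element $e$ and let $R$ be a $G$-crossed product. Suppose that $N$ is a torsion-free normal subgroup of $G$, that $G/N$ is a unique product group, and that $R_e$ is a domain. The following two assertions are equivalent: (i) Every unit in $R=\oplus_{g\in G}R_g$ is homogeneous with respect to the $G$-grading; (ii) Every unit in $R_N:=\oplus_{n\in N}R_n$ is homogeneous with respect to the $N$-grading.
   Context: Rings are associative, not necessarily commutative. A ring $R$ is $G$-graded if there is a collection $\{R_g\}_{g\in G}$ of additive subgroups of $R$ such that $R=\oplus_{g\in G}R_g$ and $R_gR_h\subseteq R_{gh}$ for all $g,h\in G$. A nonzero element is homogeneous with respect to a grading if it belongs to a single graded component. A unital $G$-graded ring $R$ is a $G$-crossed product if, for each $g\in G$, the component $R_g$ contains an element which is invertible in $R$. For a subgroup $N$ of $G$, $R_N$ is a unital subring of $R$ graded by $N$ with components $R_n$, $n\in N$. A domain is a nonzero (not necessarily commutative) ring in which the product of any two nonzero elements is nonzero. A group $\Gamma$ is a unique product group if, given any two non-empty finite subsets $A$ and $B$ of $\Gamma$, there exists at least one element $g\in\Gamma$ which has a unique representation of the form $g=ab$ with $a\in A$ and $b\in B$. *)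

theory Defs
  imports "HOL-Algebra.Algebra"
begin

text \<open>
  A homogeneous family over \<open>S\<close> with finite support, and its sum.  The families
  are extensional, so that uniqueness of a decomposition is plain equality of functions.
\<close>

definition fin_families ::
  "('r, 'k) ring_scheme \<Rightarrow> ('g \<Rightarrow> 'r set) \<Rightarrow> 'g set \<Rightarrow> ('g \<Rightarrow> 'r) set" where
  "fin_families R C S = {f \<in> (\<Pi>\<^sub>E g\<in>S. C g). finite {g \<in> S. f g \<noteq> \<zero>\<^bsub>R\<^esub>}}"

definition family_sum ::
  "('r, 'k) ring_scheme \<Rightarrow> 'g set \<Rightarrow> ('g \<Rightarrow> 'r) \<Rightarrow> 'r" where
  "family_sum R S f = (\<Oplus>\<^bsub>R\<^esub>g\<in>{g \<in> S. f g \<noteq> \<zero>\<^bsub>R\<^esub>}. f g)"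

locale graded_ring = G: group G + R: ring R
  for G :: "('g, 'm) monoid_scheme" (structure)
    and R :: "('r, 'k) ring_scheme" (structure) +
  fixes C :: "'g \<Rightarrow> 'r set"
  assumes component_subgroup: "g \<in> carrier G \<Longrightarrow> additive_subgroup (C g) R"
    and component_mult:
      "\<lbrakk>g \<in> carrier G; h \<in> carrier G; x \<in> C g; y \<in> C h\<rbrakk>
        \<Longrightarrow> x \<otimes>\<^bsub>R\<^esub> y \<in> C (g \<otimes>\<^bsub>G\<^esub> h)"
    and direct_sum:
      "x \<in> carrier R \<Longrightarrow>
        \<exists>!f. f \<in> fin_families R C (carrier G) \<and> x = family_sum R (carrier G) f"

locale crossed_product = graded_ring +
  assumes component_unit: "g \<in> carrier G \<Longrightarrow> C g \<inter> Units R \<noteq> {}"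

definition homogeneous ::
  "('g, 'm) monoid_scheme \<Rightarrow> ('r, 'k) ring_scheme \<Rightarrow> ('g \<Rightarrow> 'r set) \<Rightarrow> 'r \<Rightarrow> bool" where
  "homogeneous G R C x \<longleftrightarrow> x \<noteq> \<zero>\<^bsub>R\<^esub> \<and> (\<exists>g\<in>carrier G. x \<in> C g)"

definition restrict_group ::
  "('g, 'm) monoid_scheme \<Rightarrow> 'g set \<Rightarrow> ('g, 'm) monoid_scheme" where
  "restrict_group G N = G\<lparr>carrier := N\<rparr>"

definition graded_subring ::
  "('r, 'k) ring_scheme \<Rightarrow> ('g \<Rightarrow> 'r set) \<Rightarrow> 'g set \<Rightarrow> ('r, 'k) ring_scheme" where
  "graded_subring R C N = R\<lparr>carrier := family_sum R N ` fin_families R C N\<rparr>"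

text \<open>The library locale \<^locale>\<open>domain\<close> is commutative.\<close>

locale noncomm_domain = ring +
  assumes nonzero: "carrier R \<noteq> {\<zero>}"
    and no_zero_divisors:
      "\<lbrakk>a \<in> carrier R; b \<in> carrier R; a \<noteq> \<zero>; b \<noteq> \<zero>\<rbrakk> \<Longrightarrow> a \<otimes> b \<noteq> \<zero>"

definition torsion_free :: "('g, 'm) monoid_scheme \<Rightarrow> bool" where
  "torsion_free G \<longleftrightarrow>
    (\<forall>x\<in>carrier G. \<forall>n::nat. n > 0 \<longrightarrow> x [^]\<^bsub>G\<^esub> n = \<one>\<^bsub>G\<^esub> \<longrightarrow> x = \<one>\<^bsub>G\<^esub>)"

locale unique_product_group = group +
  assumes unique_product:
    "\<lbrakk>finite A; A \<noteq> {}; A \<subseteq> carrier G; finite B; B \<noteq> {}; B \<subseteq> carrier G\<rbrakk>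
      \<Longrightarrow> \<exists>g\<in>carrier G. \<exists>!p. p \<in> A \<times> B \<and> g = fst p \<otimes> snd p"

end

theory Submission
  imports Defs
begin

text \<open>
  Write \<open>R\<^sub>N\<close> for the subring of elements whose homogeneous components have degree in \<open>N\<close>.
  One direction is immediate: a unit of \<open>R\<^sub>N\<close> is a unit of \<open>R\<close>, and if it is homogeneous in \<open>R\<close>,
  then its degree lies in \<open>N\<close>.

  For the converse, \<open>R\<close> is also a crossed product for the coarser grading by \<open>G/N\<close>, whose identity
  component is \<open>R\<^sub>N\<close> (\<open>crossed_product_factor_group\<close>).  Suppose that \<open>R\<^sub>N\<close> is a domain and that
  \<open>u v = 1\<close> in \<open>R\<close>.  A product of a degree of \<open>u\<close> and a degree of \<open>v\<close> that arises in only one way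
  is the degree of a nonzero component of \<open>u v\<close>, so it is trivial.  By a theorem of Strojnowski
  (\<open>two_unique_products\<close>) a unique product group provides two such products unless \<open>u\<close> and \<open>v\<close>
  have just one degree each; hence \<open>u\<close> is homogeneous for \<open>G/N\<close>
  (\<open>units_homogeneous_of_unique_product\<close>).  A homogeneous unit \<open>w\<close> of \<open>R\<close> moves it to a
  unit \<open>u w\<close> of \<open>R\<^sub>N\<close>; this is homogeneous by (ii), and therefore so is \<open>u\<close>.

  It remains to see that (ii) forces \<open>R\<^sub>N\<close> to be a domain (\<open>domain_of_units_homogeneous\<close>).  If
  \<open>x y = 0\<close> with \<open>x\<close> and \<open>y\<close> nonzero, and if \<open>R\<^sub>N\<close> is prime, then \<open>c = y z x\<close> is nonzero for some
  \<open>z\<close>, while \<open>c c = 0\<close>.  So \<open>1 + c\<close> is a unit, and comparing components shows that it cannot be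
  homogeneous.

  Primeness (\<open>torsion_free_imp_prime\<close>) comes from a property of the torsion-free group \<open>N\<close>: for
  finite nonempty \<open>A\<close> and \<open>B\<close> there is an \<open>h\<close> for which some product \<open>a h b\<close> is attained only once
  (\<open>torsion_free_imp_separating_element\<close>).  Taking the sets of degrees of \<open>x\<close> and \<open>y\<close> for \<open>A\<close> and
  \<open>B\<close> and a unit \<open>z\<close> of degree \<open>h\<close>, the element \<open>x z y\<close> has a nonzero component.  To find \<open>h\<close>, let
  \<open>\<Delta>\<close> be the subgroup of elements with finitely many conjugates.  A coincidence
  \<open>a h b = a' h b'\<close> says that \<open>h\<close> conjugates the quotient of \<open>a\<close> and \<open>a'\<close> into a fixed finite
  set.  If this quotient is not in \<open>\<Delta>\<close>, then such \<open>h\<close> lie in finitely many cosets of a centralizer of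
  infinite index, and by B. H. Neumann's lemma (\<open>subgroup_covering\<close>) some \<open>h\<close> avoids all of these.
  What is left takes place inside \<open>\<Delta>\<close>, which is abelian by a transfer argument
  (\<open>fc_center_comm\<close>) and so, being torsion-free, can be totally ordered; products of
  greatest elements are then unique.
\<close>

section \<open>Coverings by cosets and centralizers\<close>

context group
begin

lemma inv_cancel:
  assumes "x \<in> carrier G" and "y \<in> carrier G"
  shows "inv x \<otimes> (x \<otimes> y) = y" and "x \<otimes> (inv x \<otimes> y) = y"
  using assms by (simp_all flip: m_assoc)

lemmas group_normalize = m_assoc inv_mult_group inv_cancel

text \<open>
  B. H. Neumann's lemma: in a covering of a group by finitely many cosets, one of the subgroups
  involved has finite index.  The proof discards one subgroup at a time.  If the cosets
  of \<open>H\<close> do not cover the group, then a coset of \<open>H\<close> not among them is covered by the cosets of the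
  other subgroups, and translating this covering covers all cosets of \<open>H\<close>.  Letting all
  subgroups share one set \<open>F\<close> of representatives loses nothing, as \<open>F\<close> may be enlarged.
\<close>

lemma subgroup_covering:
  assumes "finite \<H>" and "\<And>H. H \<in> \<H> \<Longrightarrow> subgroup H G"
    and "finite F" and "F \<subseteq> carrier G" and "carrier G \<subseteq> (\<Union>H\<in>\<H>. H <#> F)"
  shows "\<exists>H\<in>\<H>. \<exists>F'. finite F' \<and> F' \<subseteq> carrier G \<and> carrier G \<subseteq> H <#> F'"
  using assms
proof (induction \<H> arbitrary: F rule: finite_induct)
  case empty
  then show ?case using one_closed by blast
next
  case (insert H \<H>)
  interpret H: subgroup H G using insert.prems by simp
  show ?case
  proof (cases "carrier G \<subseteq> H <#> F")
    case True
    then show ?thesis using insert.prems by blast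
  next
    case False
    then obtain g where g: "g \<in> carrier G" and g_notin: "g \<notin> H <#> F"
      by blast
    \<comment> \<open>\<open>H g\<close> is covered by the other subgroups, and right multiplication by \<open>inv g \<otimes> f'\<close>
      carries it onto \<open>H f'\<close>; \<open>F2\<close> collects the representatives that this requires.\<close>
    define F2 where "F2 = F \<union> (\<lambda>(f, f'). f \<otimes> inv g \<otimes> f') ` (F \<times> F)"
    have F2: "finite F2" "F2 \<subseteq> carrier G"
      using insert.prems g by (auto simp: F2_def)
    have "y \<in> (\<Union>K\<in>\<H>. K <#> F2)" if y: "y \<in> carrier G" for y
    proof (cases "y \<in> (\<Union>K\<in>\<H>. K <#> F)")
      case True
      then show ?thesis by (force simp: set_mult_def F2_def)
    next
      case False
      then have "y \<in> H <#> F" using insert.prems y by auto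
      then obtain h f' where h: "h \<in> H" and f': "f' \<in> F" and y_eq: "y = h \<otimes> f'"
        by (auto simp: set_mult_def)
      have h_car: "h \<in> carrier G" using h by simp
      have "h \<otimes> g \<notin> H <#> F"
      proof
        assume "h \<otimes> g \<in> H <#> F"
        then obtain k f where kf: "k \<in> H" "f \<in> F" and "h \<otimes> g = k \<otimes> f"
          by (auto simp: set_mult_def)
        then have "inv h \<otimes> (h \<otimes> g) = inv h \<otimes> k \<otimes> f"
          using insert.prems h_car by (auto simp: m_assoc)
        then have "g = inv h \<otimes> k \<otimes> f" using h_car g by (simp add: inv_cancel)
        then show False using g_notin kf h by (force simp: set_mult_def)
      qed
      then obtain K k f where K: "K \<in> \<H>" and kf: "k \<in> K" "f \<in> F" and hg: "h \<otimes> g = k \<otimes> f"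
      proof -
        have "h \<otimes> g \<in> (\<Union>K\<in>insert H \<H>. K <#> F)"
          by (rule subsetD[OF insert.prems(4) m_closed[OF h_car g]])
        then have "h \<otimes> g \<in> (\<Union>K\<in>\<H>. K <#> F)"
          using \<open>h \<otimes> g \<notin> H <#> F\<close> by simp
        then obtain K where "K \<in> \<H>" and "h \<otimes> g \<in> K <#> F" by blast
        then show thesis using that unfolding set_mult_def by blast
      qed
      have k_car: "k \<in> carrier G"
        using K kf insert.prems(1) subgroup.mem_carrier by (metis insertCI)
      have fs: "f \<in> carrier G" "f' \<in> carrier G" using kf f' insert.prems by auto
      have "y = (h \<otimes> g) \<otimes> inv g \<otimes> f'"
        using h_car g fs by (simp add: y_eq group_normalize)
      also have "\<dots> = k \<otimes> (f \<otimes> inv g \<otimes> f')"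
        using k_car g fs by (simp add: hg group_normalize)
      finally show ?thesis using K kf f' by (force simp: set_mult_def F2_def)
    qed
    then have "\<exists>H\<in>\<H>. \<exists>F'. finite F' \<and> F' \<subseteq> carrier G \<and> carrier G \<subseteq> H <#> F'"
      by (intro insert.IH[of F2] insert.prems(1) F2) auto
    then show ?thesis by blast
  qed
qed

definition centralizer :: "'a set \<Rightarrow> 'a set" where
  "centralizer S = {g \<in> carrier G. \<forall>s\<in>S. g \<otimes> s = s \<otimes> g}"

lemma subgroup_centralizer:
  assumes "S \<subseteq> carrier G"
  shows "subgroup (centralizer S) G"
proof
  show "centralizer S \<subseteq> carrier G" by (auto simp: centralizer_def)
  show "\<one> \<in> centralizer S" using assms by (auto simp: centralizer_def)
next
  fix x y assume xy: "x \<in> centralizer S" "y \<in> centralizer S"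
  have "x \<otimes> y \<otimes> s = s \<otimes> (x \<otimes> y)" if "s \<in> S" for s
  proof -
    have "x \<otimes> y \<otimes> s = x \<otimes> (s \<otimes> y)"
      using xy that assms by (auto simp: centralizer_def m_assoc)
    also have "\<dots> = s \<otimes> (x \<otimes> y)"
      using xy that assms by (auto simp: centralizer_def simp flip: m_assoc)
    finally show ?thesis .
  qed
  then show "x \<otimes> y \<in> centralizer S" using xy by (auto simp: centralizer_def)
next
  fix x assume x: "x \<in> centralizer S"
  then have x_car: "x \<in> carrier G" by (simp add: centralizer_def)
  have "inv x \<otimes> s = s \<otimes> inv x" if "s \<in> S" for s
  proof -
    have "inv x \<otimes> s = inv x \<otimes> (s \<otimes> x) \<otimes> inv x"
      using x that assms by (auto simp: centralizer_def m_assoc)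
    also have "\<dots> = inv x \<otimes> (x \<otimes> s) \<otimes> inv x"
      using x that by (auto simp: centralizer_def)
    also have "\<dots> = s \<otimes> inv x"
      using x subsetD[OF assms that] by (simp add: x_car group_normalize)
    finally show ?thesis .
  qed
  then show "inv x \<in> centralizer S" using x by (auto simp: centralizer_def)
qed

text \<open>
  The elements that conjugate \<open>w\<close> to a given element form a coset of the centralizer of \<open>w\<close>.  This
  turns statements about conjugates into statements about coverings by cosets.
\<close>

lemma conj_eq_iff_centralizer:
  assumes "w \<in> carrier G" and "k \<in> carrier G" and "h \<in> carrier G"
  shows "inv k \<otimes> w \<otimes> k = inv h \<otimes> w \<otimes> h \<longleftrightarrow> k \<otimes> inv h \<in> centralizer {w}"
proof
  assume eq: "inv k \<otimes> w \<otimes> k = inv h \<otimes> w \<otimes> h"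
  have "k \<otimes> inv h \<otimes> w = k \<otimes> (inv h \<otimes> w \<otimes> h) \<otimes> inv h"
    using assms by (simp add: group_normalize)
  also have "\<dots> = w \<otimes> (k \<otimes> inv h)"
    using assms by (simp add: group_normalize flip: eq)
  finally show "k \<otimes> inv h \<in> centralizer {w}" using assms by (simp add: centralizer_def)
next
  assume "k \<otimes> inv h \<in> centralizer {w}"
  then have eq: "k \<otimes> inv h \<otimes> w = w \<otimes> (k \<otimes> inv h)" by (simp add: centralizer_def)
  have "inv k \<otimes> w \<otimes> k = inv k \<otimes> (w \<otimes> (k \<otimes> inv h)) \<otimes> h"
    using assms by (simp add: group_normalize)
  also have "\<dots> = inv h \<otimes> w \<otimes> h"
    unfolding eq[symmetric] using assms by (simp add: group_normalize)
  finally show "inv k \<otimes> w \<otimes> k = inv h \<otimes> w \<otimes> h" .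
qed

section \<open>The FC-center of a torsion-free group\<close>

definition conj_class :: "'a \<Rightarrow> 'a set" where
  "conj_class x = (\<lambda>g. inv g \<otimes> x \<otimes> g) ` carrier G"

definition fc_center :: "'a set" where
  "fc_center = {x \<in> carrier G. finite (conj_class x)}"

lemma conj_class_conj:
  assumes "x \<in> carrier G" and "h \<in> carrier G"
  shows "conj_class (inv h \<otimes> x \<otimes> h) = conj_class x"
proof
  have *: "conj_class (inv h \<otimes> x \<otimes> h) \<subseteq> conj_class x"
    if "x \<in> carrier G" "h \<in> carrier G" for x h
  proof
    fix u assume "u \<in> conj_class (inv h \<otimes> x \<otimes> h)"
    then obtain g where g: "g \<in> carrier G" and "u = inv g \<otimes> (inv h \<otimes> x \<otimes> h) \<otimes> g"
      by (auto simp: conj_class_def)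
    then have "u = inv (h \<otimes> g) \<otimes> x \<otimes> (h \<otimes> g)" using that by (simp add: group_normalize)
    then show "u \<in> conj_class x" using g that by (auto simp: conj_class_def)
  qed
  show "conj_class (inv h \<otimes> x \<otimes> h) \<subseteq> conj_class x" using * assms by blast
  have "inv (inv h) \<otimes> (inv h \<otimes> x \<otimes> h) \<otimes> inv h = x"
    using assms by (simp add: group_normalize)
  then show "conj_class x \<subseteq> conj_class (inv h \<otimes> x \<otimes> h)"
    using *[of "inv h \<otimes> x \<otimes> h" "inv h"] assms by simp
qed

lemma fc_center_conj:
  assumes "x \<in> fc_center" and "h \<in> carrier G"
  shows "inv h \<otimes> x \<otimes> h \<in> fc_center"
  using assms conj_class_conj by (auto simp: fc_center_def)

lemma subgroup_fc_center: "subgroup fc_center G"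
proof
  show "fc_center \<subseteq> carrier G" by (auto simp: fc_center_def)
  have "conj_class \<one> \<subseteq> {\<one>}" by (auto simp: conj_class_def)
  then show "\<one> \<in> fc_center" by (auto simp: fc_center_def intro: finite_subset)
next
  fix x y assume xy: "x \<in> fc_center" "y \<in> fc_center"
  have "conj_class (x \<otimes> y) \<subseteq> (\<lambda>(u, v). u \<otimes> v) ` (conj_class x \<times> conj_class y)"
  proof
    fix u assume "u \<in> conj_class (x \<otimes> y)"
    then obtain g where g: "g \<in> carrier G" and "u = inv g \<otimes> (x \<otimes> y) \<otimes> g"
      by (auto simp: conj_class_def)
    then have "u = (inv g \<otimes> x \<otimes> g) \<otimes> (inv g \<otimes> y \<otimes> g)"
      using xy by (simp add: group_normalize fc_center_def)
    then show "u \<in> (\<lambda>(u, v). u \<otimes> v) ` (conj_class x \<times> conj_class y)"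
      using g by (auto simp: conj_class_def)
  qed
  moreover have "finite ((\<lambda>(u, v). u \<otimes> v) ` (conj_class x \<times> conj_class y))"
    using xy by (auto simp: fc_center_def)
  ultimately show "x \<otimes> y \<in> fc_center"
    using xy by (auto simp: fc_center_def intro: finite_subset)
next
  fix x assume x: "x \<in> fc_center"
  have "conj_class (inv x) \<subseteq> (\<lambda>u. inv u) ` conj_class x"
  proof
    fix u assume "u \<in> conj_class (inv x)"
    then obtain g where g: "g \<in> carrier G" and "u = inv g \<otimes> inv x \<otimes> g"
      by (auto simp: conj_class_def)
    then have "u = inv (inv g \<otimes> x \<otimes> g)"
      using x by (simp add: group_normalize fc_center_def)
    then show "u \<in> (\<lambda>u. inv u) ` conj_class x" using g by (auto simp: conj_class_def)
  qed
  then show "inv x \<in> fc_center"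
    using x by (auto simp: fc_center_def intro: finite_subset)
qed

text \<open>
  Otherwise the group would be covered by the finitely many solution sets of
  \<open>inv h \<otimes> d \<otimes> h = e\<close>, which are cosets of centralizers; one of these centralizers would have
  finite index, giving \<open>d\<close> only finitely many conjugates.
\<close>

lemma exists_conjugator_avoiding:
  assumes "finite D" and "D \<subseteq> carrier G - fc_center" and "finite E"
  shows "\<exists>h\<in>carrier G. \<forall>d\<in>D. inv h \<otimes> d \<otimes> h \<notin> E"
proof (rule ccontr)
  assume "\<not> ?thesis"
  then have bad: "\<exists>d\<in>D. inv h \<otimes> d \<otimes> h \<in> E" if "h \<in> carrier G" for h using that by blast
  \<comment> \<open>A representative of the coset of solutions for \<open>d\<close> and \<open>e\<close>; if there are none, the value
    is arbitrary, and the intersection with the carrier keeps \<open>F\<close> inside the group.\<close>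
  define pick where "pick = (\<lambda>(d, e). SOME f. f \<in> carrier G \<and> inv f \<otimes> d \<otimes> f = e)"
  define F where "F = pick ` (D \<times> E) \<inter> carrier G"
  have "carrier G \<subseteq> (\<Union>H\<in>(\<lambda>d. centralizer {d}) ` D. H <#> F)"
  proof
    fix h assume h: "h \<in> carrier G"
    obtain d where d: "d \<in> D" and e: "inv h \<otimes> d \<otimes> h \<in> E" using bad[OF h] by blast
    define f where "f = pick (d, inv h \<otimes> d \<otimes> h)"
    have "f \<in> carrier G \<and> inv f \<otimes> d \<otimes> f = inv h \<otimes> d \<otimes> h"
      unfolding f_def pick_def prod.case by (rule someI[where x = h]) (simp add: h)
    then have f: "f \<in> carrier G" and eq: "inv f \<otimes> d \<otimes> f = inv h \<otimes> d \<otimes> h" by auto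
    have fF: "f \<in> F" using f d e by (auto simp: F_def f_def)
    have d_car: "d \<in> carrier G" using d assms by auto
    have "h \<otimes> inv f \<in> centralizer {d}"
      using conj_eq_iff_centralizer[OF d_car h f] eq by simp
    moreover have "h = (h \<otimes> inv f) \<otimes> f" using h f by (simp add: group_normalize)
    ultimately show "h \<in> (\<Union>H\<in>(\<lambda>d. centralizer {d}) ` D. H <#> F)"
      using d fF unfolding set_mult_def by blast
  qed
  moreover have "subgroup H G" if "H \<in> (\<lambda>d. centralizer {d}) ` D" for H
    using that assms by (auto intro!: subgroup_centralizer)
  moreover have "finite F" "F \<subseteq> carrier G" using assms by (auto simp: F_def)
  ultimately obtain d F' where d: "d \<in> D" and F': "finite F'" "F' \<subseteq> carrier G"
    and cover: "carrier G \<subseteq> centralizer {d} <#> F'"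
    using subgroup_covering[of "(\<lambda>d. centralizer {d}) ` D" F] assms by auto
  have d_car: "d \<in> carrier G" using d assms by auto
  have "conj_class d \<subseteq> (\<lambda>f. inv f \<otimes> d \<otimes> f) ` F'"
  proof
    fix u assume "u \<in> conj_class d"
    then obtain g where g: "g \<in> carrier G" and u: "u = inv g \<otimes> d \<otimes> g"
      by (auto simp: conj_class_def)
    obtain k f where k: "k \<in> centralizer {d}" and f: "f \<in> F'" and "g = k \<otimes> f"
      using cover g by (auto simp: set_mult_def)
    moreover have "f \<in> carrier G" "k \<in> carrier G" using f F' k by (auto simp: centralizer_def)
    ultimately have "g \<otimes> inv f \<in> centralizer {d}" by (simp add: group_normalize)
    then have "u = inv f \<otimes> d \<otimes> f"
      using conj_eq_iff_centralizer[OF d_car g \<open>f \<in> carrier G\<close>] by (simp add: u)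
    then show "u \<in> (\<lambda>f. inv f \<otimes> d \<otimes> f) ` F'" using f by blast
  qed
  then have "d \<in> fc_center"
    using d_car F' by (auto simp: fc_center_def intro: finite_subset)
  then show False using d assms by blast
qed

lemma torsion_freeD:
  assumes "torsion_free G" and "x \<in> carrier G" and "n > 0" and "x [^] (n::nat) = \<one>"
  shows "x = \<one>"
  using assms by (auto simp: torsion_free_def)

lemma torsion_free_subset:
  assumes "torsion_free G" and "H \<subseteq> carrier G"
  shows "torsion_free (G\<lparr>carrier := H\<rparr>)"
  using assms unfolding torsion_free_def by (auto simp flip: nat_pow_consistent)

lemma power_in_finite_index:
  assumes Z: "subgroup Z G" and fin: "finite (rcosets Z)" and c: "c \<in> carrier G"
  shows "\<exists>m>0. c [^] (m::nat) \<in> Z"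
proof -
  have "(\<lambda>i::nat. Z #> c [^] i) ` UNIV \<subseteq> rcosets Z"
    using rcosetsI[OF subgroup.subset[OF Z]] c by auto
  then have "finite (range (\<lambda>i::nat. Z #> c [^] i))" using fin finite_subset by blast
  then have "\<not> inj (\<lambda>i::nat. Z #> c [^] i)" using finite_imageD infinite_UNIV_nat by blast
  then obtain i j :: nat where ij: "i < j" and eq: "Z #> c [^] i = Z #> c [^] j"
    unfolding inj_on_def by (auto simp: neq_iff)
  have "c [^] j \<in> Z #> c [^] i"
    using rcos_self[OF nat_pow_closed[OF c] Z] eq by simp
  then have "c [^] j \<otimes> inv (c [^] i) \<in> Z"
    using subgroup.rcos_module_imp[OF Z is_group nat_pow_closed[OF c]] by simp
  moreover have "c [^] j = c [^] (j - i) \<otimes> c [^] i"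
    using ij c by (simp add: nat_pow_mult)
  ultimately have "c [^] (j - i) \<in> Z" using c by (simp add: group_normalize)
  then show ?thesis using ij by (intro exI[of _ "j - i"]) simp
qed

text \<open>
  The transfer into a central subgroup \<open>Z\<close> of finite index \<open>n\<close> is a homomorphism to an abelian
  group, so it kills commutators; on \<open>Z\<close> itself it is the \<open>n\<close>-th power.  A power of a commutator
  lies in \<open>Z\<close>, hence a further power of it is trivial, and torsion-freeness makes the commutator
  trivial.
\<close>

lemma finite_index_center_imp_comm:
  assumes tf: "torsion_free G" and Z: "subgroup Z G" and fin: "finite (rcosets Z)"
    and central: "\<And>z g. z \<in> Z \<Longrightarrow> g \<in> carrier G \<Longrightarrow> z \<otimes> g = g \<otimes> z"
    and x: "x \<in> carrier G" and y: "y \<in> carrier G"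
  shows "x \<otimes> y = y \<otimes> x"
proof -
  interpret Z: subgroup Z G by fact
  interpret A: comm_group "G\<lparr>carrier := Z\<rparr>"
    by (rule group.group_comm_groupI) (use central in \<open>auto simp: Z.subgroup_is_group\<close>)
  define r where "r P = (SOME u. u \<in> P)" for P :: "'a set"
  have r_mem: "r P \<in> P" if "P \<in> rcosets Z" for P
    using Z.rcosets_non_empty[OF that] by (auto simp: r_def some_in_eq)
  have r_car: "r P \<in> carrier G" if "P \<in> rcosets Z" for P
    using r_mem that Z.rcosets_carrier[OF is_group that] by blast
  have shift: "P #> g \<in> rcosets Z" if P: "P \<in> rcosets Z" and g: "g \<in> carrier G" for P g
  proof -
    obtain a where a: "a \<in> carrier G" "P = Z #> a" using P by (auto simp: RCOSETS_def)
    then have "P #> g = Z #> (a \<otimes> g)" using g by (simp add: coset_mult_assoc Z.subset)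
    then show ?thesis using a g by (auto intro: rcosetsI simp: Z.subset)
  qed
  have shift_shift: "P #> g #> h = P #> (g \<otimes> h)"
    if "P \<in> rcosets Z" "g \<in> carrier G" "h \<in> carrier G" for P g h
    using that Z.rcosets_carrier[OF is_group] by (simp add: coset_mult_assoc)
  have shift_bij: "bij_betw (\<lambda>P. P #> g) (rcosets Z) (rcosets Z)" if g: "g \<in> carrier G" for g
    by (rule bij_betw_byWitness[where f' = "\<lambda>P. P #> inv g"])
      (use g shift Z.rcosets_carrier[OF is_group] in
        \<open>auto simp: shift_shift coset_mult_one\<close>)
  \<comment> \<open>\<open>t g P\<close> measures the failure of the representatives \<open>r\<close> to commute with translation by
    \<open>g\<close>, and \<open>V\<close>, the product of all these defects, is the transfer.\<close>
  define t where "t g P = r P \<otimes> g \<otimes> inv (r (P #> g))" for g P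
  have t_mem: "t g P \<in> Z" if P: "P \<in> rcosets Z" and g: "g \<in> carrier G" for g P
  proof -
    have "r P \<otimes> g \<in> P #> g" using r_mem[OF P] by (auto simp: r_coset_def)
    then show ?thesis
      unfolding t_def by (rule diff_neutralizes[OF Z shift[OF P g] _ r_mem[OF shift[OF P g]]])
  qed
  define V where "V g = finprod (G\<lparr>carrier := Z\<rparr>) (t g) (rcosets Z)" for g
  have V_mem: "V g \<in> Z" if "g \<in> carrier G" for g
    using A.finprod_closed[of "t g" "rcosets Z"] t_mem that by (auto simp: V_def)
  have V_mult: "V (g \<otimes> h) = V g \<otimes> V h" if g: "g \<in> carrier G" and h: "h \<in> carrier G" for g h
  proof -
    have "V (g \<otimes> h) = finprod (G\<lparr>carrier := Z\<rparr>)
        (\<lambda>P. t g P \<otimes>\<^bsub>G\<lparr>carrier := Z\<rparr>\<^esub> t h (P #> g)) (rcosets Z)"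
      unfolding V_def
    proof (rule A.finprod_cong')
      show "(\<lambda>P. t g P \<otimes>\<^bsub>G\<lparr>carrier := Z\<rparr>\<^esub> t h (P #> g))
          \<in> rcosets Z \<rightarrow> carrier (G\<lparr>carrier := Z\<rparr>)"
        using t_mem shift g h by auto
      show "t (g \<otimes> h) P = t g P \<otimes>\<^bsub>G\<lparr>carrier := Z\<rparr>\<^esub> t h (P #> g)"
        if P: "P \<in> rcosets Z" for P
        using r_car P shift g h
        by (simp add: t_def shift_shift group_normalize)
    qed simp
    also have "\<dots> = V g \<otimes>
        finprod (G\<lparr>carrier := Z\<rparr>) (\<lambda>P. t h (P #> g)) (rcosets Z)"
      unfolding V_def
      by (subst A.finprod_multf) (use t_mem shift g h in auto)
    also have "finprod (G\<lparr>carrier := Z\<rparr>) (\<lambda>P. t h (P #> g)) (rcosets Z) = V h"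
      using A.finprod_reindex[of "t h" "\<lambda>P. P #> g" "rcosets Z"] shift_bij[OF g] t_mem h
      unfolding V_def bij_betw_def by auto
    finally show ?thesis .
  qed
  have V_one: "V \<one> = \<one>"
    using V_mult[of \<one> \<one>] V_mem[of \<one>] by (simp add: r_cancel_one)
  have V_central: "V z = z [^] card (rcosets Z)" if z: "z \<in> Z" for z
  proof -
    have "t z P = z" if P: "P \<in> rcosets Z" for P
    proof -
      obtain a where a: "a \<in> carrier G" "P = Z #> a" using P by (auto simp: RCOSETS_def)
      have "P #> z = Z #> (z \<otimes> a)"
        using a z central by (simp add: coset_mult_assoc Z.subset)
      also have "\<dots> = Z #> z #> a"
        using a z by (simp add: coset_mult_assoc Z.subset)
      also have "\<dots> = P" using a z coset_join2[of z Z] Z by simp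
      finally have "P #> z = P" .
      then show ?thesis using r_car[OF P] z central by (simp add: t_def group_normalize flip: central)
    qed
    then have "V z = finprod (G\<lparr>carrier := Z\<rparr>) (\<lambda>_. z) (rcosets Z)"
      unfolding V_def by (intro A.finprod_cong') (use z in auto)
    also have "\<dots> = z [^] card (rcosets Z)"
      using z by (simp add: A.finprod_const flip: nat_pow_consistent)
    finally show ?thesis .
  qed
  have V_pow: "V (g [^] m) = V g [^] m" if "g \<in> carrier G" for g and m :: nat
    using that by (induction m) (simp_all add: V_one V_mult)
  define c where "c = x \<otimes> y \<otimes> inv (y \<otimes> x)"
  have c: "c \<in> carrier G" using x y by (simp add: c_def)
  have "V c \<otimes> V (y \<otimes> x) = V (x \<otimes> y)"
    using x y c by (simp add: c_def group_normalize flip: V_mult)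
  also have "\<dots> = V (y \<otimes> x)"
    using x y V_mem by (simp add: V_mult central)
  finally have "V c = \<one>" using V_mem c x y by (simp add: l_cancel_one)
  obtain m :: nat where m: "m > 0" "c [^] m \<in> Z" using power_in_finite_index[OF Z fin c] by blast
  have "c [^] (m * card (rcosets Z)) = V (c [^] m)"
    using c m by (simp add: V_central nat_pow_pow)
  also have "\<dots> = \<one>" using c by (simp add: V_pow \<open>V c = \<one>\<close>)
  finally have "c [^] (m * card (rcosets Z)) = \<one>" .
  moreover have "card (rcosets Z) > 0"
    using fin Z.subgroup_in_rcosets[OF is_group] by (auto simp: card_gt_0_iff)
  ultimately have "c = \<one>" using torsion_freeD[OF tf c, of "m * card (rcosets Z)"] m by simp
  then have "x \<otimes> y \<otimes> inv (y \<otimes> x) \<otimes> (y \<otimes> x) = y \<otimes> x" using x y by (simp add: c_def)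
  then show ?thesis using x y by (simp add: group_normalize)
qed

text \<open>
  The centralizer \<open>A\<close> of \<open>x\<close> and \<open>y\<close> has finite index, and \<open>x\<close> and \<open>y\<close> lie in the centralizer
  \<open>H\<close> of \<open>A\<close>.  In \<open>H\<close> the subgroup \<open>A \<inter> H\<close> is central and still of finite index.
\<close>

lemma fc_center_comm:
  assumes tf: "torsion_free G" and x: "x \<in> fc_center" and y: "y \<in> fc_center"
  shows "x \<otimes> y = y \<otimes> x"
proof -
  have xy: "x \<in> carrier G" "y \<in> carrier G" using x y by (auto simp: fc_center_def)
  define A where "A = centralizer {x, y}"
  define H where "H = centralizer A"
  have A: "subgroup A G" using xy by (auto simp: A_def intro!: subgroup_centralizer)
  have H: "subgroup H G"
    unfolding H_def by (rule subgroup_centralizer) (rule subgroup.subset[OF A])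
  interpret H: group "G\<lparr>carrier := H\<rparr>" using H by (rule subgroup.subgroup_is_group) (rule is_group)
  have xH: "x \<in> H" "y \<in> H" using xy by (auto simp: H_def A_def centralizer_def)
  have sub: "subgroup (A \<inter> H) (G\<lparr>carrier := H\<rparr>)"
    by (rule subgroup_incl[OF subgroups_Inter_pair[OF A H] H]) simp
  \<comment> \<open>A coset of \<open>A \<inter> H\<close> in \<open>H\<close> is determined by the conjugates of \<open>x\<close> and \<open>y\<close> under its elements.\<close>
  define P where "P = (\<lambda>(u, v). {k \<in> H. inv k \<otimes> x \<otimes> k = u \<and> inv k \<otimes> y \<otimes> k = v})"
  have "rcosets\<^bsub>G\<lparr>carrier := H\<rparr>\<^esub> (A \<inter> H) \<subseteq> P ` (conj_class x \<times> conj_class y)"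
  proof
    fix Q assume "Q \<in> rcosets\<^bsub>G\<lparr>carrier := H\<rparr>\<^esub> (A \<inter> H)"
    then obtain h where h: "h \<in> H" and Q: "Q = (A \<inter> H) #> h" by (auto simp: RCOSETS_def)
    have h_car: "h \<in> carrier G" by (rule subgroup.mem_carrier[OF H h])
    have mem: "k \<in> Q \<longleftrightarrow> k \<in> P (inv h \<otimes> x \<otimes> h, inv h \<otimes> y \<otimes> h)" for k
    proof (cases "k \<in> H")
      case True
      then have k: "k \<in> carrier G" by (rule subgroup.mem_carrier[OF H])
      have "k \<in> Q \<longleftrightarrow> k \<otimes> inv h \<in> A \<inter> H"
        unfolding Q
        by (rule subgroup.rcos_module[OF subgroups_Inter_pair[OF A H] is_group h_car k])
      also have "\<dots> \<longleftrightarrow> k \<otimes> inv h \<in> A"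
        using True h subgroupE(3,4)[OF H] by auto
      also have "\<dots> \<longleftrightarrow> k \<in> P (inv h \<otimes> x \<otimes> h, inv h \<otimes> y \<otimes> h)"
        using True xy k h_car by (simp add: P_def conj_eq_iff_centralizer A_def) (simp add: centralizer_def)
      finally show ?thesis .
    next
      case False
      then show ?thesis using subgroupE(4)[OF H] h by (auto simp: P_def Q r_coset_def)
    qed
    have "Q = P (inv h \<otimes> x \<otimes> h, inv h \<otimes> y \<otimes> h)" by (rule Set.set_eqI) (rule mem)
    then show "Q \<in> P ` (conj_class x \<times> conj_class y)"
      using h_car by (intro image_eqI[where f = P]) (auto simp: conj_class_def)
  qed
  then have "finite (rcosets\<^bsub>G\<lparr>carrier := H\<rparr>\<^esub> (A \<inter> H))"
    using x y by (auto simp: fc_center_def intro: finite_subset)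
  then have "x \<otimes>\<^bsub>G\<lparr>carrier := H\<rparr>\<^esub> y = y \<otimes>\<^bsub>G\<lparr>carrier := H\<rparr>\<^esub> x"
  proof (rule H.finite_index_center_imp_comm[OF torsion_free_subset[OF tf subgroup.subset[OF H]] sub])
    show "z \<otimes>\<^bsub>G\<lparr>carrier := H\<rparr>\<^esub> g = g \<otimes>\<^bsub>G\<lparr>carrier := H\<rparr>\<^esub> z"
      if "z \<in> A \<inter> H" "g \<in> carrier (G\<lparr>carrier := H\<rparr>)" for z g
      using that by (simp add: H_def centralizer_def)
  qed (simp_all add: xH)
  then show ?thesis by simp
qed

end

section \<open>Unique products in torsion-free abelian groups\<close>

context comm_group
begin

text \<open>
  The elements above \<open>\<one>\<close> for a partial order that is invariant under translation.
\<close>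

definition cone :: "'a set \<Rightarrow> bool" where
  "cone P \<longleftrightarrow> P \<subseteq> carrier G \<and> \<one> \<in> P \<and> (\<forall>x\<in>P. \<forall>y\<in>P. x \<otimes> y \<in> P)
    \<and> (\<forall>x\<in>P. inv x \<in> P \<longrightarrow> x = \<one>)"

lemma cone_pow: "cone P \<Longrightarrow> x \<in> P \<Longrightarrow> x [^] (n::nat) \<in> P"
  by (induction n) (auto simp: cone_def)

text \<open>
  Levi's theorem that torsion-free abelian groups can be totally ordered.  A maximal cone contains every element
  of which it contains a positive power: adjoining all such roots again gives a cone, by
  torsion-freeness.  If \<open>inv x\<close> is not in the cone, it therefore contains no positive power of \<open>inv x\<close>, and so
  adjoining \<open>x\<close> gives a cone, whence \<open>x\<close> is in the maximal one.
\<close>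

lemma torsion_free_imp_total_cone:
  assumes tf: "torsion_free G"
  obtains P where "cone P" and "\<And>x. x \<in> carrier G \<Longrightarrow> x \<in> P \<or> inv x \<in> P"
proof -
  have "\<exists>M\<in>{P. cone P}. (\<forall>Y\<in>{P. cone P}. M \<subseteq> Y \<longrightarrow> Y = M)"
  proof (rule subset_Zorn_nonempty)
    have "cone {\<one>}" by (simp add: cone_def)
    then show "{P. cone P} \<noteq> {}" by blast
  next
    fix \<C> assume ne: "\<C> \<noteq> {}" and chain: "subset.chain ({P. cone P}) \<C>"
    have cones: "cone Y" if "Y \<in> \<C>" for Y using chain that by (auto simp: subset.chain_def)
    have common: "\<exists>Y\<in>\<C>. x \<in> Y \<and> y \<in> Y" if "x \<in> \<Union>\<C>" "y \<in> \<Union>\<C>" for x y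
      using chain that by (meson UnionE subsetD subset_chain_def)
    have "\<Union>\<C> \<subseteq> carrier G" using cones unfolding cone_def by blast
    moreover have "\<one> \<in> \<Union>\<C>" using ne cones by (auto simp: cone_def)
    moreover have "x \<otimes> y \<in> \<Union>\<C>" if xy: "x \<in> \<Union>\<C>" "y \<in> \<Union>\<C>" for x y
    proof -
      obtain Y where Y: "Y \<in> \<C>" "x \<in> Y" "y \<in> Y" using common[OF xy] by auto
      then have "x \<otimes> y \<in> Y" using cones[OF Y(1)] by (simp add: cone_def)
      then show ?thesis using Y by blast
    qed
    moreover have "x = \<one>" if x: "x \<in> \<Union>\<C>" "inv x \<in> \<Union>\<C>" for x
    proof -
      obtain Y where Y: "Y \<in> \<C>" "x \<in> Y" "inv x \<in> Y" using common[OF x] by auto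
      then show ?thesis using cones[OF Y(1)] by (simp add: cone_def)
    qed
    ultimately have "cone (\<Union>\<C>)" unfolding cone_def by (intro conjI ballI impI)
    then show "\<Union>\<C> \<in> {P. cone P}" by simp
  qed
  then obtain P where P: "cone P" and maximal: "\<And>Y. cone Y \<Longrightarrow> P \<subseteq> Y \<Longrightarrow> Y = P" by auto
  have P_car: "P \<subseteq> carrier G" using P by (simp add: cone_def)
  have root: "x \<in> P" if x: "x \<in> carrier G" and n: "n > 0" and xn: "x [^] (n::nat) \<in> P" for x n
  proof -
    define Q where "Q = {x \<in> carrier G. \<exists>n::nat. n > 0 \<and> x [^] n \<in> P}"
    have mult: "u \<otimes> v \<in> Q" if uv: "u \<in> Q" "v \<in> Q" for u v
    proof -
      obtain k l :: nat where kl: "k > 0" "u [^] k \<in> P" "l > 0" "v [^] l \<in> P"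
        and car: "u \<in> carrier G" "v \<in> carrier G"
        using uv by (auto simp: Q_def)
      have "(u \<otimes> v) [^] (k * l) = (u [^] k) [^] l \<otimes> (v [^] l) [^] k"
        using car by (simp add: nat_pow_distrib nat_pow_pow mult.commute)
      also have "\<dots> \<in> P" using P kl cone_pow by (simp add: cone_def)
      finally show ?thesis using car kl by (auto simp: Q_def intro!: exI[of _ "k * l"])
    qed
    have proper: "u = \<one>" if u: "u \<in> Q" "inv u \<in> Q" for u
    proof -
      obtain k l :: nat where kl: "k > 0" "u [^] k \<in> P" "l > 0" "inv u [^] l \<in> P"
        and car: "u \<in> carrier G"
        using u by (auto simp: Q_def)
      have "u [^] (k * l) \<in> P"
        using cone_pow[OF P kl(2), of l] car by (simp add: nat_pow_pow)
      moreover have "inv (u [^] (k * l)) \<in> P"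
        using cone_pow[OF P kl(4), of k] car
        by (simp add: nat_pow_pow nat_pow_inv mult.commute)
      ultimately have "u [^] (k * l) = \<one>" using P by (simp add: cone_def)
      then show ?thesis using torsion_freeD[OF tf car, of "k * l"] kl by simp
    qed
    have PQ: "P \<subseteq> Q" using P_car by (auto simp: Q_def intro!: exI[of _ "1::nat"])
    have "Q \<subseteq> carrier G" by (auto simp: Q_def)
    moreover have "\<one> \<in> Q" using PQ P by (auto simp: cone_def)
    ultimately have "cone Q"
      unfolding cone_def using mult proper by (intro conjI ballI impI)
    then have "Q = P" using PQ maximal by blast
    then show ?thesis using x n xn by (auto simp: Q_def)
  qed
  have "x \<in> P \<or> inv x \<in> P" if x: "x \<in> carrier G" for x
  proof (rule disjCI)
    assume inv_notin: "inv x \<notin> P"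
    define Q where "Q = {p \<otimes> x [^] k | p k. p \<in> P \<and> (k::nat) \<in> UNIV}"
    have PQ: "P \<subseteq> Q"
    proof
      fix p assume "p \<in> P"
      then show "p \<in> Q" using P_car by (auto simp: Q_def intro!: exI[of _ p] exI[of _ "0::nat"])
    qed
    have mult: "u \<otimes> v \<in> Q" if uv: "u \<in> Q" "v \<in> Q" for u v
    proof -
      obtain p q and k l :: nat where pq: "p \<in> P" "q \<in> P"
        and eq: "u = p \<otimes> x [^] k" "v = q \<otimes> x [^] l"
        using uv by (auto simp: Q_def)
      have car: "p \<in> carrier G" "q \<in> carrier G" using pq P_car by auto
      have "u \<otimes> v = (p \<otimes> q) \<otimes> x [^] (k + l)"
        using car x by (simp add: eq m_ac flip: nat_pow_mult)
      moreover have "p \<otimes> q \<in> P" using P pq by (simp add: cone_def)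
      ultimately show ?thesis by (auto simp: Q_def)
    qed
    have proper: "u = \<one>" if uv: "u \<in> Q" "inv u \<in> Q" for u
    proof -
      obtain p q and k l :: nat where pq: "p \<in> P" "q \<in> P"
        and eq: "u = p \<otimes> x [^] k" "inv u = q \<otimes> x [^] l"
        using uv by (auto simp: Q_def)
      have car: "p \<in> carrier G" "q \<in> carrier G" "u \<in> carrier G" using pq P_car x eq by auto
      have "\<one> = u \<otimes> inv u" using car by simp
      also have "\<dots> = (p \<otimes> q) \<otimes> x [^] (k + l)"
        unfolding eq(2) unfolding eq(1) using car x by (simp add: m_ac flip: nat_pow_mult)
      finally have prod: "(p \<otimes> q) \<otimes> x [^] (k + l) = \<one>" by simp
      have pqP: "p \<otimes> q \<in> P" using P pq by (simp add: cone_def)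
      have "inv (x [^] (k + l)) = p \<otimes> q"
        using prod car x by (metis inv_equality m_closed nat_pow_closed)
      then have "inv x [^] (k + l) \<in> P" using pqP x by (simp add: nat_pow_inv)
      then have "k + l = 0" using root[of "inv x" "k + l"] inv_notin x by blast
      then have "u = p" "inv u = q" using eq car by auto
      then show ?thesis using P pq by (auto simp: cone_def)
    qed
    have "Q \<subseteq> carrier G" using P_car x by (auto simp: Q_def)
    moreover have "\<one> \<in> Q" using PQ P by (auto simp: cone_def)
    ultimately have "cone Q"
      unfolding cone_def using mult proper by (intro conjI ballI impI)
    then have "Q = P" using PQ maximal by blast
    moreover have "x \<in> Q"
    proof -
      have "\<one> \<in> P" "x = \<one> \<otimes> x [^] (1::nat)" using P x by (simp_all add: cone_def)
      then show ?thesis unfolding Q_def by blast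
    qed
    ultimately show "x \<in> P" by simp
  qed
  then show thesis by (rule that[OF P])
qed

lemma cone_greatest:
  assumes P: "cone P" and total: "\<And>x. x \<in> carrier G \<Longrightarrow> x \<in> P \<or> inv x \<in> P"
    and "finite A" and "A \<noteq> {}" and "A \<subseteq> carrier G"
  shows "\<exists>m\<in>A. \<forall>a\<in>A. inv a \<otimes> m \<in> P"
  using assms(3-5)
proof (induction A rule: finite_ne_induct)
  case (singleton x)
  then show ?case using P by (simp add: cone_def)
next
  case (insert x A)
  then obtain m where m: "m \<in> A" "\<And>a. a \<in> A \<Longrightarrow> inv a \<otimes> m \<in> P" by auto
  have car: "m \<in> carrier G" "x \<in> carrier G" using insert m by auto
  show ?case
  proof (cases "inv x \<otimes> m \<in> P")
    case True
    then show ?thesis using m by auto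
  next
    case False
    then have xm: "inv m \<otimes> x \<in> P"
      using total[of "inv x \<otimes> m"] car by (simp add: group_normalize)
    have "inv a \<otimes> x \<in> P" if a: "a \<in> A" for a
    proof -
      have "a \<in> carrier G" using a insert by auto
      then have "inv a \<otimes> x = (inv a \<otimes> m) \<otimes> (inv m \<otimes> x)"
        using car by (simp add: m_assoc inv_cancel)
      then show ?thesis using P m(2)[OF a] xm by (simp add: cone_def)
    qed
    moreover have "inv x \<otimes> x \<in> P" using car P by (simp add: cone_def)
    ultimately show ?thesis by auto
  qed
qed

text \<open>
  For a total order the product of the greatest elements of \<open>A\<close> and \<open>B\<close> is attained only once.
\<close>

lemma torsion_free_imp_unique_product:
  assumes tf: "torsion_free G"
    and A: "finite A" "A \<noteq> {}" "A \<subseteq> carrier G" and B: "finite B" "B \<noteq> {}" "B \<subseteq> carrier G"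
  shows "\<exists>a\<in>A. \<exists>b\<in>B. \<forall>a'\<in>A. \<forall>b'\<in>B. a' \<otimes> b' = a \<otimes> b \<longrightarrow> a' = a \<and> b' = b"
proof -
  obtain P where P: "cone P" and total: "\<And>x. x \<in> carrier G \<Longrightarrow> x \<in> P \<or> inv x \<in> P"
    using torsion_free_imp_total_cone[OF tf] by blast
  obtain a where a: "a \<in> A" and a_max: "\<And>a'. a' \<in> A \<Longrightarrow> inv a' \<otimes> a \<in> P"
    using cone_greatest[OF P total A] by auto
  obtain b where b: "b \<in> B" and b_max: "\<And>b'. b' \<in> B \<Longrightarrow> inv b' \<otimes> b \<in> P"
    using cone_greatest[OF P total B] by auto
  have "a' = a \<and> b' = b" if a': "a' \<in> A" and b': "b' \<in> B" and eq: "a' \<otimes> b' = a \<otimes> b" for a' b'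
  proof -
    have car: "a \<in> carrier G" "b \<in> carrier G" "a' \<in> carrier G" "b' \<in> carrier G"
      using a b a' b' A B by auto
    have "inv b' \<otimes> b = inv (a' \<otimes> b') \<otimes> (a' \<otimes> b)"
      using car by (simp add: group_normalize)
    also have "\<dots> = inv (inv a' \<otimes> a)"
      using car unfolding eq by (simp add: inv_mult_group inv_cancel m_ac)
    finally have "inv a' \<otimes> a = \<one>"
      using P a_max[OF a'] b_max[OF b'] by (simp add: cone_def)
    then have "a' \<otimes> (inv a' \<otimes> a) = a'" using car by simp
    then have "a' = a" using car by (simp add: inv_cancel)
    then show ?thesis using eq car by simp
  qed
  then show ?thesis using a b by blast
qed

end

section \<open>Separating elements and unique products\<close>

context group
begin

text \<open>
  Since \<open>a' \<otimes> h \<otimes> b' = a \<otimes> h \<otimes> b\<close> means \<open>inv h \<otimes> (inv a \<otimes> a') \<otimes> h = b \<otimes> inv b'\<close>, an \<open>h\<close>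
  that conjugates no \<open>inv a \<otimes> a'\<close> outside the FC-center into the finite set of quotients of
  \<open>B\<close> restricts all coincidences to single cosets of the FC-center.  Replacing \<open>A\<close> and \<open>B\<close> by
  their intersections \<open>A0\<close> and \<open>B0\<close> with such cosets, the claim becomes the unique product
  property of the FC-center, which is abelian.
\<close>

theorem torsion_free_imp_separating_element:
  assumes tf: "torsion_free G"
    and A: "finite A" "A \<noteq> {}" "A \<subseteq> carrier G" and B: "finite B" "B \<noteq> {}" "B \<subseteq> carrier G"
  shows "\<exists>h\<in>carrier G. \<exists>a\<in>A. \<exists>b\<in>B. \<forall>a'\<in>A. \<forall>b'\<in>B.
    a' \<otimes> h \<otimes> b' = a \<otimes> h \<otimes> b \<longrightarrow> a' = a \<and> b' = b"
proof -
  interpret F: subgroup fc_center G by (rule subgroup_fc_center)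
  have comm: "comm_group (G\<lparr>carrier := fc_center\<rparr>)"
    by (rule group.group_comm_groupI)
      (use fc_center_comm[OF tf] in \<open>auto simp: F.subgroup_is_group\<close>)
  obtain a1 b1 where a1: "a1 \<in> A" and b1: "b1 \<in> B" using A B by blast
  have a1b1: "a1 \<in> carrier G" "b1 \<in> carrier G" using a1 b1 A B by auto
  define D where "D = (\<lambda>(a, a'). inv a \<otimes> a') ` (A \<times> A) - fc_center"
  define E where "E = (\<lambda>(b, b'). b \<otimes> inv b') ` (B \<times> B)"
  have "finite D" "finite E" using A B by (auto simp: D_def E_def)
  moreover have "D \<subseteq> carrier G - fc_center" using A by (auto simp: D_def)
  ultimately obtain h where h: "h \<in> carrier G" and avoid: "\<And>d. d \<in> D \<Longrightarrow> inv h \<otimes> d \<otimes> h \<notin> E"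
    using exists_conjugator_avoiding by meson
  define A0 where "A0 = {a \<in> A. inv a1 \<otimes> a \<in> fc_center}"
  define B0 where "B0 = {b \<in> B. b \<otimes> inv b1 \<in> fc_center}"
  \<comment> \<open>These translations move \<open>A0\<close> and \<open>B0\<close> into the FC-center, and \<open>p a \<otimes> q b\<close> is a two-sided
    translate of \<open>a \<otimes> h \<otimes> b\<close>.\<close>
  define p where "p a = inv a1 \<otimes> a" for a
  define q where "q b = h \<otimes> (b \<otimes> inv b1) \<otimes> inv h" for b
  have car: "a \<in> carrier G" if "a \<in> A \<or> a \<in> B" for a using that A B by auto
  have pA: "p ` A0 \<subseteq> fc_center" by (auto simp: p_def A0_def)
  have qB: "q ` B0 \<subseteq> fc_center"
    using fc_center_conj[of _ "inv h"] h by (auto simp: q_def B0_def)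
  have "a1 \<in> A0" "b1 \<in> B0" using a1 b1 a1b1 by (auto simp: A0_def B0_def)
  then have ne: "p ` A0 \<noteq> {}" "q ` B0 \<noteq> {}" by auto
  have fin: "finite (p ` A0)" "finite (q ` B0)" using A B by (auto simp: A0_def B0_def)
  have "\<exists>u\<in>p ` A0. \<exists>v\<in>q ` B0. \<forall>u'\<in>p ` A0. \<forall>v'\<in>q ` B0. u' \<otimes> v' = u \<otimes> v \<longrightarrow> u' = u \<and> v' = v"
    using comm_group.torsion_free_imp_unique_product
      [OF comm torsion_free_subset[OF tf F.subset] fin(1) ne(1) _ fin(2) ne(2)] pA qB
    by simp
  then obtain a b where a: "a \<in> A0" and b: "b \<in> B0"
    and unique: "\<And>a' b'. a' \<in> A0 \<Longrightarrow> b' \<in> B0 \<Longrightarrow> p a' \<otimes> q b' = p a \<otimes> q b \<Longrightarrow> p a' = p a \<and> q b' = q b"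
    by blast
  have a_car: "a \<in> A" "a \<in> carrier G" and b_car: "b \<in> B" "b \<in> carrier G"
    using a b car by (auto simp: A0_def B0_def)
  have "a' = a \<and> b' = b"
    if a': "a' \<in> A" and b': "b' \<in> B" and eq: "a' \<otimes> h \<otimes> b' = a \<otimes> h \<otimes> b" for a' b'
  proof -
    have a'_car: "a' \<in> carrier G" and b'_car: "b' \<in> carrier G" using a' b' car by auto
    have "inv h \<otimes> (inv a \<otimes> a') \<otimes> h = inv h \<otimes> inv a \<otimes> (a' \<otimes> h \<otimes> b') \<otimes> inv b'"
      using h a_car a'_car b'_car by (simp add: group_normalize)
    also have "\<dots> = b \<otimes> inv b'"
      unfolding eq using h a_car b_car b'_car by (simp add: group_normalize)
    finally have conj: "inv h \<otimes> (inv a \<otimes> a') \<otimes> h = b \<otimes> inv b'" .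
    have "inv a \<otimes> a' \<notin> D"
      using avoid[of "inv a \<otimes> a'"] conj b_car(1) b' by (auto simp: E_def)
    then have a'a: "inv a \<otimes> a' \<in> fc_center" using a_car(1) a' by (auto simp: D_def)
    then have "b \<otimes> inv b' \<in> fc_center" using fc_center_conj[OF a'a h] conj by simp
    then have "inv (b \<otimes> inv b') \<otimes> (b \<otimes> inv b1) \<in> fc_center"
      using b by (auto simp: B0_def)
    moreover have "inv (b \<otimes> inv b') \<otimes> (b \<otimes> inv b1) = b' \<otimes> inv b1"
      using b_car b'_car a1b1 by (simp add: group_normalize)
    ultimately have b'0: "b' \<in> B0" using b' by (simp add: B0_def)
    have "(inv a1 \<otimes> a) \<otimes> (inv a \<otimes> a') \<in> fc_center"
      using a a'a by (auto simp: A0_def)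
    then have a'0: "a' \<in> A0"
      using a' a_car a'_car a1b1 by (simp add: A0_def group_normalize)
    have "p a' \<otimes> q b' = inv a1 \<otimes> (a' \<otimes> h \<otimes> b') \<otimes> inv b1 \<otimes> inv h"
      using h a1b1 a'_car b'_car by (simp add: p_def q_def group_normalize)
    also have "\<dots> = p a \<otimes> q b"
      unfolding eq using h a1b1 a_car b_car by (simp add: p_def q_def group_normalize)
    finally have "p a' = p a \<and> q b' = q b" using unique a'0 b'0 by blast
    then show ?thesis using h a1b1 a_car b_car a'_car b'_car by (simp add: p_def q_def)
  qed
  then show ?thesis using h a_car(1) b_car(1) by blast
qed

definition unique_product_pair :: "'a set \<Rightarrow> 'a set \<Rightarrow> 'a \<Rightarrow> 'a \<Rightarrow> bool" where
  "unique_product_pair A B a b \<longleftrightarrow> a \<in> A \<and> b \<in> B \<and>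
    (\<forall>a'\<in>A. \<forall>b'\<in>B. a' \<otimes> b' = a \<otimes> b \<longrightarrow> a' = a \<and> b' = b)"

end

lemma (in unique_product_group) exists_unique_product_pair:
  assumes A: "finite A" "A \<noteq> {}" "A \<subseteq> carrier G" and B: "finite B" "B \<noteq> {}" "B \<subseteq> carrier G"
  shows "\<exists>a b. unique_product_pair A B a b"
proof -
  obtain g p where p: "p \<in> A \<times> B" "g = fst p \<otimes> snd p"
    and unique: "\<And>q. q \<in> A \<times> B \<and> g = fst q \<otimes> snd q \<Longrightarrow> q = p"
    using unique_product[OF A B] by blast
  have "unique_product_pair A B (fst p) (snd p)"
    unfolding unique_product_pair_def using p unique by fastforce
  then show ?thesis by blast
qed

text \<open>
  Strojnowski's argument.  Normalize the given pair to \<open>a = b = \<one>\<close>, and suppose that it is the only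
  one.  Then no product of an element of \<open>P = B\<^sup>-\<^sup>1 A\<close> and an element of \<open>Q = B A\<^sup>-\<^sup>1\<close> would be
  attained only once: in \<open>(v\<^sup>-\<^sup>1 u) (t s\<^sup>-\<^sup>1)\<close> the inner factor \<open>u t\<close> can be written
  differently unless \<open>u = t = \<one>\<close>, the factor \<open>v\<^sup>-\<^sup>1 s\<^sup>-\<^sup>1 = (s v)\<^sup>-\<^sup>1\<close> can be written differently unless
  \<open>s = v = \<one>\<close>, and in the remaining case the product is \<open>\<one>\<close>, which is also \<open>u u\<^sup>-\<^sup>1\<close> and \<open>v\<^sup>-\<^sup>1 v\<close>
  for all \<open>u\<close> in \<open>A\<close> and \<open>v\<close> in \<open>B\<close>, not all of them trivial.  This contradicts the unique product property of \<open>P\<close> and \<open>Q\<close>.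
\<close>

theorem (in unique_product_group) two_unique_products:
  assumes A: "finite A" "A \<subseteq> carrier G" and B: "finite B" "B \<subseteq> carrier G"
    and pair: "unique_product_pair A B a b" and large: "A \<noteq> {a} \<or> B \<noteq> {b}"
  shows "\<exists>a' b'. unique_product_pair A B a' b' \<and> (a' \<noteq> a \<or> b' \<noteq> b)"
proof (rule ccontr)
  assume neg: "\<not> ?thesis"
  have ab: "a \<in> A" "b \<in> B" "a \<in> carrier G" "b \<in> carrier G"
    using pair A B by (auto simp: unique_product_pair_def)
  have car: "u \<in> carrier G" if "u \<in> A \<or> u \<in> B" for u using that A B by auto
  have other: "\<exists>u'\<in>A. \<exists>v'\<in>B. u' \<otimes> v' = u \<otimes> v \<and> u' \<noteq> u \<and> v' \<noteq> v"
    if uv: "u \<in> A" "v \<in> B" and "u \<noteq> a \<or> v \<noteq> b" for u v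
  proof -
    have "\<not> unique_product_pair A B u v" using neg that by blast
    then obtain u' v' where u'v': "u' \<in> A" "v' \<in> B" "u' \<otimes> v' = u \<otimes> v" "u' \<noteq> u \<or> v' \<noteq> v"
      using uv unfolding unique_product_pair_def by blast
    moreover have "u \<in> carrier G" "v \<in> carrier G" "u' \<in> carrier G" "v' \<in> carrier G"
      using uv u'v' car by auto
    ultimately have "u' \<noteq> u \<and> v' \<noteq> v" using l_cancel r_cancel by metis
    then show ?thesis using u'v' by blast
  qed
  \<comment> \<open>The factors \<open>inv a \<otimes> u\<close> and \<open>v \<otimes> inv b\<close> normalize the pair \<open>a\<close>, \<open>b\<close> to the identity.\<close>
  define p where "p u v = inv (v \<otimes> inv b) \<otimes> (inv a \<otimes> u)" for u v
  define q where "q u v = (v \<otimes> inv b) \<otimes> inv (inv a \<otimes> u)" for u v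
  define P where "P = (\<lambda>(u, v). p u v) ` (A \<times> B)"
  define Q where "Q = (\<lambda>(u, v). q u v) ` (A \<times> B)"
  have closed: "p u v \<in> carrier G" "q u v \<in> carrier G" if "u \<in> A" "v \<in> B" for u v
    using that ab car by (auto simp: p_def q_def)
  have PQ_car: "P \<subseteq> carrier G" "Q \<subseteq> carrier G" using closed by (auto simp: P_def Q_def)
  moreover have "finite P" "P \<noteq> {}" "finite Q" "Q \<noteq> {}"
    using A B ab by (auto simp: P_def Q_def)
  ultimately obtain c d where cd: "unique_product_pair P Q c d"
    using exists_unique_product_pair by metis
  then have "c \<in> P" "d \<in> Q" by (simp_all add: unique_product_pair_def)
  then obtain u v s t where u: "u \<in> A" and v: "v \<in> B" and s: "s \<in> A" and t: "t \<in> B"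
    and c: "c = p u v" and d: "d = q s t"
    by (auto simp: P_def Q_def)
  have cars: "u \<in> carrier G" "v \<in> carrier G" "s \<in> carrier G" "t \<in> carrier G"
    using u v s t car by auto
  have unique: "p u' v' = p u v"
    if "u' \<in> A" "v' \<in> B" "s' \<in> A" "t' \<in> B" "p u' v' \<otimes> q s' t' = p u v \<otimes> q s t" for u' v' s' t'
    using cd that unfolding unique_product_pair_def c d P_def Q_def by blast
  have prod: "p u' v' \<otimes> q s' t' = b \<otimes> inv v' \<otimes> inv a \<otimes> (u' \<otimes> t') \<otimes> inv b \<otimes> inv s' \<otimes> a"
    if "u' \<in> carrier G" "v' \<in> carrier G" "s' \<in> carrier G" "t' \<in> carrier G" for u' v' s' t'
    using that ab by (simp add: p_def q_def group_normalize)
  have ut: "u = a" "t = b"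
  proof -
    have False if ne: "u \<noteq> a \<or> t \<noteq> b"
    proof -
      obtain u' t' where u't': "u' \<in> A" "t' \<in> B" and eq: "u' \<otimes> t' = u \<otimes> t" and "u' \<noteq> u"
        using other[OF u t ne] by blast
      have "p u' v \<otimes> q s t' = p u v \<otimes> q s t"
        using u't' cars car eq by (simp add: prod)
      then have "p u' v = p u v" using unique u't' s v by blast
      then show False using \<open>u' \<noteq> u\<close> cars car u't' ab by (simp add: p_def)
    qed
    then show "u = a" "t = b" by auto
  qed
  have sv: "s = a" "v = b"
  proof -
    have False if ne: "s \<noteq> a \<or> v \<noteq> b"
    proof -
      obtain s' v' where s'v': "s' \<in> A" "v' \<in> B" and eq: "s' \<otimes> v' = s \<otimes> v" and "v' \<noteq> v"
        using other[OF s v ne] by blast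
      have car': "s' \<in> carrier G" "v' \<in> carrier G" using s'v' car by auto
      have "p a v' \<otimes> q s' b = b \<otimes> inv (s' \<otimes> v') \<otimes> a"
        using cars car' ab by (simp add: p_def q_def group_normalize)
      also have "\<dots> = p a v \<otimes> q s b"
        unfolding eq using cars ab by (simp add: p_def q_def group_normalize)
      finally have "p a v' = p a v" using unique[of a v' s' b] s'v' ab ut by simp
      then have "inv (v' \<otimes> inv b) = inv (v \<otimes> inv b)" using ab by (simp add: p_def cars car')
      then have "inv (inv (v' \<otimes> inv b)) = inv (inv (v \<otimes> inv b))" by simp
      then have "v' \<otimes> inv b = v \<otimes> inv b" using ab cars car' by (simp only: inv_inv m_closed inv_closed)
      then show False using \<open>v' \<noteq> v\<close> cars car' ab by simp
    qed
    then show "s = a" "v = b" by auto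
  qed
  have all_p: "p u' v' = \<one>" if "u' \<in> A" "v' \<in> B" "u' = a \<or> v' = b" for u' v'
  proof -
    have "p u' v' \<otimes> q u' v' = \<one>"
      using that(3) car[of u'] car[of v'] that(1,2) ab
      by (auto simp: p_def q_def group_normalize)
    moreover have "p u v = \<one>" "q s t = \<one>"
      using ab by (simp_all add: p_def q_def ut sv)
    ultimately show ?thesis using unique[OF that(1,2,1,2)] by simp
  qed
  have "u' = a" if u': "u' \<in> A" for u'
  proof -
    have u'_car: "u' \<in> carrier G" using u' car by simp
    have "u' = a \<otimes> (inv a \<otimes> u')" using u'_car ab by (simp add: inv_cancel)
    also have "inv a \<otimes> u' = \<one>" using all_p[OF u' ab(2)] u'_car ab by (simp add: p_def)
    finally show ?thesis using ab by simp
  qed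
  moreover have "v' = b" if v': "v' \<in> B" for v'
  proof -
    have v'_car: "v' \<in> carrier G" using v' car by simp
    have "v' = inv (inv (v' \<otimes> inv b)) \<otimes> b" using v'_car ab by (simp add: group_normalize)
    also have "inv (v' \<otimes> inv b) = \<one>" using all_p[OF ab(1) v'] v'_car ab by (simp add: p_def)
    finally show ?thesis using ab by simp
  qed
  ultimately show False using large ab by blast
qed

section \<open>Components in a graded ring\<close>

context graded_ring
begin

definition decomposition :: "'r \<Rightarrow> 'g \<Rightarrow> 'r" where
  "decomposition x =
    (THE f. f \<in> fin_families R C (carrier G) \<and> x = family_sum R (carrier G) f)"

text \<open>
  The decomposition is only specified on the group; the value zero elsewhere lets closure and
  additivity hold for every \<open>g\<close>.
\<close>

definition component :: "'g \<Rightarrow> 'r \<Rightarrow> 'r" where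
  "component g x = (if g \<in> carrier G then decomposition x g else \<zero>\<^bsub>R\<^esub>)"

definition support :: "'r \<Rightarrow> 'g set" where
  "support x = {g \<in> carrier G. component g x \<noteq> \<zero>\<^bsub>R\<^esub>}"

lemma C_closed: "g \<in> carrier G \<Longrightarrow> x \<in> C g \<Longrightarrow> x \<in> carrier R"
  using component_subgroup additive_subgroup.a_Hcarr by metis

lemma C_zero: "g \<in> carrier G \<Longrightarrow> \<zero>\<^bsub>R\<^esub> \<in> C g"
  using component_subgroup additive_subgroup.zero_closed by metis

lemma C_add: "g \<in> carrier G \<Longrightarrow> x \<in> C g \<Longrightarrow> y \<in> C g \<Longrightarrow> x \<oplus>\<^bsub>R\<^esub> y \<in> C g"
  using component_subgroup additive_subgroup.a_closed by metis

lemma decomposition_family: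
  assumes "x \<in> carrier R"
  shows "decomposition x \<in> fin_families R C (carrier G)"
    and "x = family_sum R (carrier G) (decomposition x)"
  using theI'[OF direct_sum[OF assms]] unfolding decomposition_def by auto

lemma component_mem: "x \<in> carrier R \<Longrightarrow> g \<in> carrier G \<Longrightarrow> component g x \<in> C g"
  using decomposition_family(1) by (auto simp: component_def fin_families_def)

lemma component_closed: "x \<in> carrier R \<Longrightarrow> component g x \<in> carrier R"
  using component_mem C_closed by (cases "g \<in> carrier G") (auto simp: component_def)

lemma finite_support: "x \<in> carrier R \<Longrightarrow> finite (support x)"
  using decomposition_family(1)
  by (auto simp: support_def component_def fin_families_def cong: conj_cong)

lemma support_subset: "support x \<subseteq> carrier G"
  by (auto simp: support_def)

lemma component_eq_zero: "g \<notin> support x \<Longrightarrow> component g x = \<zero>\<^bsub>R\<^esub>"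
  by (auto simp: support_def component_def)

lemma sum_components:
  assumes x: "x \<in> carrier R" and A: "finite A" "support x \<subseteq> A"
  shows "(\<Oplus>\<^bsub>R\<^esub>g\<in>A. component g x) = x"
proof -
  have "(\<Oplus>\<^bsub>R\<^esub>g\<in>support x. component g x) = (\<Oplus>\<^bsub>R\<^esub>g\<in>A. component g x)"
    by (rule R.add.finprod_mono_neutral_cong_left[OF A])
      (use x component_eq_zero component_closed in auto)
  moreover have "(\<Oplus>\<^bsub>R\<^esub>g\<in>support x. component g x) = family_sum R (carrier G) (decomposition x)"
  proof -
    have "support x = {g \<in> carrier G. decomposition x g \<noteq> \<zero>\<^bsub>R\<^esub>}"
      by (auto simp: support_def component_def)
    then show ?thesis
      unfolding family_sum_def
      by (intro R.add.finprod_cong')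
        (use decomposition_family(1)[OF x] C_closed in
          \<open>auto simp: component_def fin_families_def\<close>)
  qed
  ultimately show ?thesis using decomposition_family(2)[OF x] by simp
qed

text \<open>
  The form in which the uniqueness of decompositions is used: components can be read off from any
  expression as a sum of homogeneous elements of distinct degrees.
\<close>

lemma component_finsum_C:
  assumes A: "finite A" "A \<subseteq> carrier G" and f: "\<And>g. g \<in> A \<Longrightarrow> f g \<in> C g"
  shows "component h (\<Oplus>\<^bsub>R\<^esub>g\<in>A. f g) = (if h \<in> A then f h else \<zero>\<^bsub>R\<^esub>)"
proof -
  define F where "F = (\<lambda>g\<in>carrier G. if g \<in> A then f g else \<zero>\<^bsub>R\<^esub>)"
  have f_car: "f g \<in> carrier R" if "g \<in> A" for g using f that A C_closed by blast
  have sub: "{g \<in> carrier G. F g \<noteq> \<zero>\<^bsub>R\<^esub>} \<subseteq> A" by (auto simp: F_def split: if_splits)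
  have F: "F \<in> fin_families R C (carrier G)"
    using f C_zero finite_subset[OF sub A(1)] by (auto simp: fin_families_def F_def)
  have "family_sum R (carrier G) F = (\<Oplus>\<^bsub>R\<^esub>g\<in>A. f g)"
    unfolding family_sum_def
    by (rule R.add.finprod_mono_neutral_cong_left[OF A(1) sub])
      (use A f_car in \<open>auto simp: F_def split: if_splits\<close>)
  moreover have "(\<Oplus>\<^bsub>R\<^esub>g\<in>A. f g) \<in> carrier R" using f_car by (auto intro: R.finsum_closed)
  ultimately have "decomposition (\<Oplus>\<^bsub>R\<^esub>g\<in>A. f g) = F"
    using direct_sum decomposition_family F by metis
  then show ?thesis using A by (auto simp: component_def F_def)
qed

lemma component_homogeneous:
  assumes "g \<in> carrier G" and "x \<in> C g"
  shows "component h x = (if h = g then x else \<zero>\<^bsub>R\<^esub>)"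
  using component_finsum_C[of "{g}" "\<lambda>_. x" h] assms C_closed by simp

lemma component_zero: "component g \<zero>\<^bsub>R\<^esub> = \<zero>\<^bsub>R\<^esub>"
  using component_homogeneous[OF G.one_closed C_zero[OF G.one_closed]] by simp

lemma component_add:
  assumes x: "x \<in> carrier R" and y: "y \<in> carrier R"
  shows "component g (x \<oplus>\<^bsub>R\<^esub> y) = component g x \<oplus>\<^bsub>R\<^esub> component g y"
proof -
  define A where "A = support x \<union> support y"
  have A: "finite A" "A \<subseteq> carrier G" "support x \<subseteq> A" "support y \<subseteq> A"
    using finite_support support_subset x y by (auto simp: A_def)
  have "x \<oplus>\<^bsub>R\<^esub> y = (\<Oplus>\<^bsub>R\<^esub>g\<in>A. component g x \<oplus>\<^bsub>R\<^esub> component g y)"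
    using component_closed x y A
    by (subst R.add.finprod_multf) (auto simp: sum_components)
  moreover have "component g x \<oplus>\<^bsub>R\<^esub> component g y \<in> C g" if "g \<in> A" for g
    using C_add[OF _ component_mem[OF x] component_mem[OF y]] A(2) that by blast
  ultimately have "component g (x \<oplus>\<^bsub>R\<^esub> y)
      = (if g \<in> A then component g x \<oplus>\<^bsub>R\<^esub> component g y else \<zero>\<^bsub>R\<^esub>)"
    by (simp add: component_finsum_C[OF A(1,2)])
  moreover have "component g x = \<zero>\<^bsub>R\<^esub> \<and> component g y = \<zero>\<^bsub>R\<^esub>" if "g \<notin> A"
    using that component_eq_zero by (auto simp: A_def)
  ultimately show ?thesis by simp
qed

lemma component_finsum:
  assumes "finite I" and "\<And>i. i \<in> I \<Longrightarrow> f i \<in> carrier R"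
  shows "component g (\<Oplus>\<^bsub>R\<^esub>i\<in>I. f i) = (\<Oplus>\<^bsub>R\<^esub>i\<in>I. component g (f i))"
  using assms
proof (induction I rule: finite_induct)
  case empty
  then show ?case by (simp add: component_zero)
next
  case (insert i I)
  have "(\<Oplus>\<^bsub>R\<^esub>i\<in>I. f i) \<in> carrier R" using insert.prems by (auto intro: R.finsum_closed)
  then show ?case
    using insert by (subst (1 2) R.finsum_insert) (auto simp: component_add component_closed)
qed

lemma component_eqI:
  assumes x: "x \<in> carrier R" and y: "y \<in> carrier R"
    and eq: "\<And>g. g \<in> carrier G \<Longrightarrow> component g x = component g y"
  shows "x = y"
proof -
  have "x = (\<Oplus>\<^bsub>R\<^esub>g\<in>support x. component g x)"
    by (rule sum_components[OF x finite_support[OF x] order_refl, symmetric])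
  also have "\<dots> = (\<Oplus>\<^bsub>R\<^esub>g\<in>support x. component g y)"
  proof (rule R.add.finprod_cong')
    show "component g x = component g y" if "g \<in> support x" for g
      using eq that by (simp add: support_def)
  qed (simp_all add: component_closed y)
  also have "\<dots> = y"
    by (rule sum_components[OF y finite_support[OF x]]) (use eq in \<open>auto simp: support_def\<close>)
  finally show ?thesis .
qed

lemma mem_CI:
  assumes "x \<in> carrier R" and "g \<in> carrier G"
    and "\<And>h. h \<in> carrier G \<Longrightarrow> h \<noteq> g \<Longrightarrow> component h x = \<zero>\<^bsub>R\<^esub>"
  shows "x \<in> C g"
proof -
  have "x = component g x"
  proof (rule component_eqI[OF assms(1) component_closed[OF assms(1)]])
    show "component h x = component h (component g x)" if "h \<in> carrier G" for h
      unfolding component_homogeneous[OF assms(2) component_mem[OF assms(1,2)]]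
      using assms(3) that by simp
  qed
  then show ?thesis using component_mem[OF assms(1,2)] by simp
qed

lemma support_nonempty: "x \<in> carrier R \<Longrightarrow> x \<noteq> \<zero>\<^bsub>R\<^esub> \<Longrightarrow> support x \<noteq> {}"
  using component_eqI[of x "\<zero>\<^bsub>R\<^esub>"] component_eq_zero by (auto simp: component_zero)

lemma component_of_product:
  assumes x: "x \<in> carrier R" and y: "y \<in> carrier R"
    and A: "finite A" "support x \<subseteq> A" "A \<subseteq> carrier G"
    and B: "finite B" "support y \<subseteq> B" "B \<subseteq> carrier G"
  shows "component g (x \<otimes>\<^bsub>R\<^esub> y) = (\<Oplus>\<^bsub>R\<^esub>a\<in>A. \<Oplus>\<^bsub>R\<^esub>b\<in>B.
    if g = a \<otimes> b then component a x \<otimes>\<^bsub>R\<^esub> component b y else \<zero>\<^bsub>R\<^esub>)"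
proof -
  note closed = component_closed[OF x] component_closed[OF y]
  have "x \<otimes>\<^bsub>R\<^esub> y = (\<Oplus>\<^bsub>R\<^esub>a\<in>A. component a x) \<otimes>\<^bsub>R\<^esub> (\<Oplus>\<^bsub>R\<^esub>b\<in>B. component b y)"
    using sum_components x y A B by simp
  also have "\<dots> = (\<Oplus>\<^bsub>R\<^esub>a\<in>A. component a x \<otimes>\<^bsub>R\<^esub> (\<Oplus>\<^bsub>R\<^esub>b\<in>B. component b y))"
    using A B closed by (intro R.finsum_ldistr) (auto intro: R.finsum_closed)
  also have "\<dots> = (\<Oplus>\<^bsub>R\<^esub>a\<in>A. \<Oplus>\<^bsub>R\<^esub>b\<in>B. component a x \<otimes>\<^bsub>R\<^esub> component b y)"
    using A B closed
    by (intro R.add.finprod_cong' refl R.finsum_rdistr) (auto intro!: R.finsum_closed)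
  finally have "component g (x \<otimes>\<^bsub>R\<^esub> y)
      = (\<Oplus>\<^bsub>R\<^esub>a\<in>A. component g (\<Oplus>\<^bsub>R\<^esub>b\<in>B. component a x \<otimes>\<^bsub>R\<^esub> component b y))"
    using A B closed by (simp add: component_finsum R.finsum_closed)
  also have "\<dots> = (\<Oplus>\<^bsub>R\<^esub>a\<in>A. \<Oplus>\<^bsub>R\<^esub>b\<in>B.
      if g = a \<otimes> b then component a x \<otimes>\<^bsub>R\<^esub> component b y else \<zero>\<^bsub>R\<^esub>)"
  proof (rule R.add.finprod_cong')
    fix a assume a: "a \<in> A"
    have "component g (\<Oplus>\<^bsub>R\<^esub>b\<in>B. component a x \<otimes>\<^bsub>R\<^esub> component b y)
        = (\<Oplus>\<^bsub>R\<^esub>b\<in>B. component g (component a x \<otimes>\<^bsub>R\<^esub> component b y))"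
      using B closed by (simp add: component_finsum)
    also have "\<dots> = (\<Oplus>\<^bsub>R\<^esub>b\<in>B.
        if g = a \<otimes> b then component a x \<otimes>\<^bsub>R\<^esub> component b y else \<zero>\<^bsub>R\<^esub>)"
    proof (rule R.add.finprod_cong')
      fix b assume b: "b \<in> B"
      have "component a x \<otimes>\<^bsub>R\<^esub> component b y \<in> C (a \<otimes> b)"
        using a b A B x y by (intro component_mult component_mem) auto
      then show "component g (component a x \<otimes>\<^bsub>R\<^esub> component b y)
          = (if g = a \<otimes> b then component a x \<otimes>\<^bsub>R\<^esub> component b y else \<zero>\<^bsub>R\<^esub>)"
        using a b A B by (intro component_homogeneous) auto
    qed (use closed in auto)
    finally show "component g (\<Oplus>\<^bsub>R\<^esub>b\<in>B. component a x \<otimes>\<^bsub>R\<^esub> component b y)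
        = (\<Oplus>\<^bsub>R\<^esub>b\<in>B.
            if g = a \<otimes> b then component a x \<otimes>\<^bsub>R\<^esub> component b y else \<zero>\<^bsub>R\<^esub>)" .
  qed (use closed in \<open>auto intro!: R.finsum_closed\<close>)
  finally show ?thesis .
qed

text \<open>
  The link between unique products of degrees and products in the ring: at such a degree no
  cancellation can occur.
\<close>

lemma component_of_unique_product:
  assumes x: "x \<in> carrier R" and y: "y \<in> carrier R"
    and A: "finite A" "support x \<subseteq> A" "A \<subseteq> carrier G"
    and B: "finite B" "support y \<subseteq> B" "B \<subseteq> carrier G"
    and pair: "G.unique_product_pair A B a b"
  shows "component (a \<otimes> b) (x \<otimes>\<^bsub>R\<^esub> y) = component a x \<otimes>\<^bsub>R\<^esub> component b y"
proof -
  note closed = component_closed[OF x] component_closed[OF y]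
  let ?p = "component a x \<otimes>\<^bsub>R\<^esub> component b y"
  have ab: "a \<in> A" "b \<in> B" using pair by (auto simp: G.unique_product_pair_def)
  have "(\<Oplus>\<^bsub>R\<^esub>b'\<in>B. if a \<otimes> b = a' \<otimes> b' then component a' x \<otimes>\<^bsub>R\<^esub> component b' y else \<zero>\<^bsub>R\<^esub>)
      = (if a' = a then ?p else \<zero>\<^bsub>R\<^esub>)" if a': "a' \<in> A" for a'
  proof (cases "a' = a")
    case True
    have "(\<Oplus>\<^bsub>R\<^esub>b'\<in>B. if a \<otimes> b = a' \<otimes> b' then component a' x \<otimes>\<^bsub>R\<^esub> component b' y else \<zero>\<^bsub>R\<^esub>)
        = (\<Oplus>\<^bsub>R\<^esub>b'\<in>B. if b' = b then component a x \<otimes>\<^bsub>R\<^esub> component b' y else \<zero>\<^bsub>R\<^esub>)"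
      using True pair closed
      by (intro R.add.finprod_cong') (auto simp: G.unique_product_pair_def)
    also have "\<dots> = ?p"
      using ab B closed by (intro R.add.finprod_singleton_swap) auto
    finally show ?thesis using True by simp
  next
    case False
    have ne: "a \<otimes> b \<noteq> a' \<otimes> b'" if "b' \<in> B" for b'
      using pair that a' False unfolding G.unique_product_pair_def by metis
    show ?thesis
      using False ne by (simp add: R.add.finprod_one_eqI)
  qed
  then have "component (a \<otimes> b) (x \<otimes>\<^bsub>R\<^esub> y) = (\<Oplus>\<^bsub>R\<^esub>a'\<in>A. if a' = a then ?p else \<zero>\<^bsub>R\<^esub>)"
    unfolding component_of_product[OF x y A B] using closed
    by (intro R.add.finprod_cong') auto
  also have "\<dots> = ?p"
    using ab A closed by (intro R.add.finprod_singleton_swap) auto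
  finally show ?thesis .
qed

lemma support_of_productE:
  assumes x: "x \<in> carrier R" and y: "y \<in> carrier R" and "component g (x \<otimes>\<^bsub>R\<^esub> y) \<noteq> \<zero>\<^bsub>R\<^esub>"
  obtains a b where "a \<in> support x" and "b \<in> support y" and "g = a \<otimes> b"
proof -
  have "\<exists>a\<in>support x. \<exists>b\<in>support y. g = a \<otimes> b"
  proof (rule ccontr)
    assume *: "\<not> ?thesis"
    have "component g (x \<otimes>\<^bsub>R\<^esub> y) = \<zero>\<^bsub>R\<^esub>"
      unfolding component_of_product[OF x y finite_support[OF x] order_refl support_subset
          finite_support[OF y] order_refl support_subset]
      using * by (intro R.add.finprod_one_eqI) auto
    then show False using assms(3) by simp
  qed
  then show thesis using that by blast
qed

lemma component_of_homogeneous_product: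
  assumes g: "g \<in> carrier G" and u: "u \<in> C g" and h: "h \<in> carrier G" and y: "y \<in> carrier R"
  shows "component (g \<otimes> h) (u \<otimes>\<^bsub>R\<^esub> y) = u \<otimes>\<^bsub>R\<^esub> component h y"
proof -
  have "support u \<subseteq> {g}" using component_homogeneous[OF g u] by (auto simp: support_def)
  moreover have "G.unique_product_pair {g} (insert h (support y)) g h"
    using g h support_subset[of y] by (auto simp: G.unique_product_pair_def subset_iff)
  ultimately have "component (g \<otimes> h) (u \<otimes>\<^bsub>R\<^esub> y) = component g u \<otimes>\<^bsub>R\<^esub> component h y"
    using component_of_unique_product[of u y "{g}" "insert h (support y)" g h]
      C_closed[OF g u] y g h finite_support[OF y] support_subset[of y] by auto
  then show ?thesis using component_homogeneous[OF g u] by simp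
qed

text \<open>
  The component \<open>e\<close> of \<open>\<one>\<close> of trivial degree is a right identity: comparing degrees in
  \<open>x \<otimes> \<one> = x\<close> for homogeneous \<open>x\<close> gives \<open>x \<otimes> e = x\<close>.
\<close>

lemma one_mem_C: "\<one>\<^bsub>R\<^esub> \<in> C \<one>"
proof -
  define e where "e = component \<one> \<one>\<^bsub>R\<^esub>"
  have e: "e \<in> C \<one>" "e \<in> carrier R" by (simp_all add: e_def component_mem component_closed)
  have homog: "x \<otimes>\<^bsub>R\<^esub> e = x" if g: "g \<in> carrier G" and x: "x \<in> C g" for g x
    using component_of_homogeneous_product[OF g x G.one_closed R.one_closed]
      component_homogeneous[OF g x, of g] g C_closed[OF g x]
    by (simp add: e_def)
  have "\<one>\<^bsub>R\<^esub> \<otimes>\<^bsub>R\<^esub> e = (\<Oplus>\<^bsub>R\<^esub>g\<in>support \<one>\<^bsub>R\<^esub>. component g \<one>\<^bsub>R\<^esub>) \<otimes>\<^bsub>R\<^esub> e"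
    by (simp add: sum_components finite_support)
  also have "\<dots> = (\<Oplus>\<^bsub>R\<^esub>g\<in>support \<one>\<^bsub>R\<^esub>. component g \<one>\<^bsub>R\<^esub> \<otimes>\<^bsub>R\<^esub> e)"
    using e by (intro R.finsum_ldistr) (auto simp: finite_support component_closed)
  also have "\<dots> = (\<Oplus>\<^bsub>R\<^esub>g\<in>support \<one>\<^bsub>R\<^esub>. component g \<one>\<^bsub>R\<^esub>)"
  proof (rule R.add.finprod_cong')
    show "component g \<one>\<^bsub>R\<^esub> \<otimes>\<^bsub>R\<^esub> e = component g \<one>\<^bsub>R\<^esub>"
      if "g \<in> support \<one>\<^bsub>R\<^esub>" for g
      using homog[of g "component g \<one>\<^bsub>R\<^esub>"] component_mem[of "\<one>\<^bsub>R\<^esub>" g] that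
      by (simp add: support_def)
  qed (simp_all add: component_closed)
  also have "\<dots> = \<one>\<^bsub>R\<^esub>" by (simp add: sum_components finite_support)
  finally show ?thesis using e by simp
qed

lemma inverse_homogeneous:
  assumes g: "g \<in> carrier G" and u: "u \<in> C g" "u \<in> Units R"
  shows "inv\<^bsub>R\<^esub> u \<in> C (inv g)"
proof (rule mem_CI)
  show v: "inv\<^bsub>R\<^esub> u \<in> carrier R" using u by simp
  fix h assume h: "h \<in> carrier G" "h \<noteq> inv g"
  then have "g \<otimes> h \<noteq> \<one>" using g G.inv_equality by (metis G.inv_inv G.inv_closed)
  have "u \<otimes>\<^bsub>R\<^esub> component h (inv\<^bsub>R\<^esub> u) = component (g \<otimes> h) \<one>\<^bsub>R\<^esub>"
    using component_of_homogeneous_product[OF g u(1) h(1) v] u by simp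
  also have "\<dots> = \<zero>\<^bsub>R\<^esub>"
    using component_homogeneous[OF G.one_closed one_mem_C] \<open>g \<otimes> h \<noteq> \<one>\<close> by simp
  finally have "u \<otimes>\<^bsub>R\<^esub> component h (inv\<^bsub>R\<^esub> u) = u \<otimes>\<^bsub>R\<^esub> \<zero>\<^bsub>R\<^esub>"
    using u by (simp add: R.Units_closed)
  then show "component h (inv\<^bsub>R\<^esub> u) = \<zero>\<^bsub>R\<^esub>"
    using u component_closed[OF v] by (simp add: R.Units_l_cancel)
qed (use g in simp)

end

section \<open>Crossed products over a domain\<close>

context crossed_product
begin

lemma unit_in_component:
  assumes "g \<in> carrier G"
  obtains u where "u \<in> C g" and "u \<in> Units R" and "u \<in> carrier R"
  using component_unit[OF assms] R.Units_closed by blast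

text \<open>
  Multiplying by homogeneous units of the inverse degrees moves both factors into the identity
  component.
\<close>

lemma homogeneous_mult_nonzero:
  assumes dom: "noncomm_domain (R\<lparr>carrier := C \<one>\<rparr>)"
    and g: "g \<in> carrier G" and h: "h \<in> carrier G"
    and x: "x \<in> C g" "x \<noteq> \<zero>\<^bsub>R\<^esub>" and y: "y \<in> C h" "y \<noteq> \<zero>\<^bsub>R\<^esub>"
  shows "x \<otimes>\<^bsub>R\<^esub> y \<noteq> \<zero>\<^bsub>R\<^esub>"
proof
  assume xy: "x \<otimes>\<^bsub>R\<^esub> y = \<zero>\<^bsub>R\<^esub>"
  obtain u where u: "u \<in> C (inv g)" "u \<in> Units R" "u \<in> carrier R"
    by (rule unit_in_component[OF G.inv_closed[OF g]])
  obtain v where v: "v \<in> C (inv h)" "v \<in> Units R" "v \<in> carrier R"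
    by (rule unit_in_component[OF G.inv_closed[OF h]])
  have car: "x \<in> carrier R" "y \<in> carrier R"
    using C_closed[OF g x(1)] C_closed[OF h y(1)] by auto
  have "u \<otimes>\<^bsub>R\<^esub> x \<in> C \<one>" using component_mult[OF _ g u(1) x(1)] g by simp
  moreover have "y \<otimes>\<^bsub>R\<^esub> v \<in> C \<one>" using component_mult[OF h _ y(1) v(1)] h by simp
  moreover have "u \<otimes>\<^bsub>R\<^esub> x \<noteq> \<zero>\<^bsub>R\<^esub>"
    using u car x(2) R.Units_l_cancel[of u x "\<zero>\<^bsub>R\<^esub>"] by simp
  moreover have "y \<otimes>\<^bsub>R\<^esub> v \<noteq> \<zero>\<^bsub>R\<^esub>"
  proof
    assume "y \<otimes>\<^bsub>R\<^esub> v = \<zero>\<^bsub>R\<^esub>"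
    then have "y \<otimes>\<^bsub>R\<^esub> v \<otimes>\<^bsub>R\<^esub> inv\<^bsub>R\<^esub> v = \<zero>\<^bsub>R\<^esub>" using v by simp
    then show False using v car y(2) by (simp add: R.m_assoc)
  qed
  ultimately have "(u \<otimes>\<^bsub>R\<^esub> x) \<otimes>\<^bsub>R\<^esub> (y \<otimes>\<^bsub>R\<^esub> v) \<noteq> \<zero>\<^bsub>R\<^esub>"
    using noncomm_domain.no_zero_divisors[OF dom] by simp
  moreover have "(u \<otimes>\<^bsub>R\<^esub> x) \<otimes>\<^bsub>R\<^esub> (y \<otimes>\<^bsub>R\<^esub> v) = u \<otimes>\<^bsub>R\<^esub> (x \<otimes>\<^bsub>R\<^esub> y) \<otimes>\<^bsub>R\<^esub> v"
    using u v car by (simp add: R.m_assoc)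
  ultimately show False using xy u v by simp
qed

lemma one_neq_zero:
  assumes dom: "noncomm_domain (R\<lparr>carrier := C \<one>\<rparr>)"
  shows "\<one>\<^bsub>R\<^esub> \<noteq> \<zero>\<^bsub>R\<^esub>"
proof
  assume "\<one>\<^bsub>R\<^esub> = \<zero>\<^bsub>R\<^esub>"
  then have "x = \<zero>\<^bsub>R\<^esub>" if "x \<in> C \<one>" for x
    using C_closed[OF G.one_closed that] R.l_one R.l_null by metis
  then have "C \<one> = {\<zero>\<^bsub>R\<^esub>}" using C_zero by blast
  then show False using noncomm_domain.nonzero[OF dom] by simp
qed

text \<open>
  If \<open>u \<otimes> v = \<one>\<close>, then every degree that arises only once from the supports of \<open>u\<close> and \<open>v\<close> is the
  degree of a nonzero component of \<open>\<one>\<close>.  So there is just one such degree, and by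
  Strojnowski's theorem the supports are singletons.
\<close>

theorem units_homogeneous_of_unique_product:
  assumes up: "unique_product_group G" and dom: "noncomm_domain (R\<lparr>carrier := C \<one>\<rparr>)"
    and u: "u \<in> Units R"
  shows "homogeneous G R C u"
proof -
  interpret U: unique_product_group G by fact
  define v where "v = inv\<^bsub>R\<^esub> u"
  have car: "u \<in> carrier R" "v \<in> carrier R" and uv: "u \<otimes>\<^bsub>R\<^esub> v = \<one>\<^bsub>R\<^esub>"
    using u by (simp_all add: v_def R.Units_closed)
  have "u \<noteq> \<zero>\<^bsub>R\<^esub>" "v \<noteq> \<zero>\<^bsub>R\<^esub>" using uv car one_neq_zero[OF dom] by auto
  note supp = finite_support[OF car(1)] support_nonempty[OF car(1) \<open>u \<noteq> \<zero>\<^bsub>R\<^esub>\<close>]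
    support_subset[of u] finite_support[OF car(2)] support_nonempty[OF car(2) \<open>v \<noteq> \<zero>\<^bsub>R\<^esub>\<close>]
    support_subset[of v]
  have prod_one: "a \<otimes> b = \<one>" if pair: "G.unique_product_pair (support u) (support v) a b" for a b
  proof (rule ccontr)
    assume ne: "a \<otimes> b \<noteq> \<one>"
    have ab: "a \<in> support u" "b \<in> support v" using pair by (auto simp: G.unique_product_pair_def)
    then have ab_car: "a \<in> carrier G" "b \<in> carrier G" using support_subset by auto
    have "component (a \<otimes> b) \<one>\<^bsub>R\<^esub> = component a u \<otimes>\<^bsub>R\<^esub> component b v"
      using component_of_unique_product[OF car supp(1) order_refl supp(3,4) order_refl supp(6) pair] uv
      by simp
    moreover have "component a u \<otimes>\<^bsub>R\<^esub> component b v \<noteq> \<zero>\<^bsub>R\<^esub>"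
      by (rule homogeneous_mult_nonzero[OF dom ab_car])
        (use ab ab_car car in \<open>auto simp: component_mem support_def\<close>)
    ultimately show False
      using component_homogeneous[OF G.one_closed one_mem_C] ne by simp
  qed
  obtain a b where pair: "G.unique_product_pair (support u) (support v) a b"
    using U.exists_unique_product_pair[OF supp] by blast
  have "support u = {a}"
  proof (rule ccontr)
    assume "support u \<noteq> {a}"
    then obtain a' b' where pair': "G.unique_product_pair (support u) (support v) a' b'"
      and ne: "a' \<noteq> a \<or> b' \<noteq> b"
      using U.two_unique_products[OF supp(1,3,4,6) pair] by blast
    have "a' \<otimes> b' = a \<otimes> b" using prod_one[OF pair] prod_one[OF pair'] by simp
    then show False using pair pair' ne unfolding G.unique_product_pair_def by blast
  qed
  then have a: "a \<in> carrier G" using supp(3) by blast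
  have "u \<in> C a"
    by (rule mem_CI[OF car(1) a]) (use \<open>support u = {a}\<close> component_eq_zero in auto)
  then show ?thesis using a \<open>u \<noteq> \<zero>\<^bsub>R\<^esub>\<close> by (auto simp: homogeneous_def)
qed

text \<open>
  A unit \<open>z\<close> of degree \<open>h\<close> acts on supports as translation by \<open>h\<close>.  For a separating \<open>h\<close> of the two
  supports, \<open>x \<otimes> z \<otimes> y\<close> has a component that is a product of nonzero homogeneous elements.
\<close>

theorem torsion_free_imp_prime:
  assumes tf: "torsion_free G" and dom: "noncomm_domain (R\<lparr>carrier := C \<one>\<rparr>)"
    and x: "x \<in> carrier R" "x \<noteq> \<zero>\<^bsub>R\<^esub>" and y: "y \<in> carrier R" "y \<noteq> \<zero>\<^bsub>R\<^esub>"
  shows "\<exists>z\<in>carrier R. x \<otimes>\<^bsub>R\<^esub> z \<otimes>\<^bsub>R\<^esub> y \<noteq> \<zero>\<^bsub>R\<^esub>"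
proof -
  note supp_x = finite_support[OF x(1)] support_nonempty[OF x] support_subset[of x]
  note supp_y = finite_support[OF y(1)] support_nonempty[OF y] support_subset[of y]
  obtain h a b where h: "h \<in> carrier G" and a: "a \<in> support x" and b: "b \<in> support y"
    and unique: "\<And>a' b'. a' \<in> support x \<Longrightarrow> b' \<in> support y \<Longrightarrow>
      a' \<otimes> h \<otimes> b' = a \<otimes> h \<otimes> b \<Longrightarrow> a' = a \<and> b' = b"
    using G.torsion_free_imp_separating_element[OF tf supp_x supp_y] by blast
  obtain z where z: "z \<in> C h" "z \<in> Units R" "z \<in> carrier R" by (rule unit_in_component[OF h])
  have ab: "a \<in> carrier G" "b \<in> carrier G" using a b support_subset by auto
  define B where "B = (\<lambda>b. h \<otimes> b) ` support y"
  have "support (z \<otimes>\<^bsub>R\<^esub> y) \<subseteq> B"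
  proof
    fix g assume g: "g \<in> support (z \<otimes>\<^bsub>R\<^esub> y)"
    then obtain a' b' where "a' \<in> support z" "b' \<in> support y" "g = a' \<otimes> b'"
      using support_of_productE[OF z(3) y(1), of g] by (auto simp: support_def)
    moreover have "support z \<subseteq> {h}" using component_homogeneous[OF h z(1)] by (auto simp: support_def)
    ultimately show "g \<in> B" by (auto simp: B_def)
  qed
  moreover have "G.unique_product_pair (support x) B a (h \<otimes> b)"
    unfolding G.unique_product_pair_def
  proof (intro conjI ballI impI)
    fix a' c assume a': "a' \<in> support x" and c: "c \<in> B" and eq: "a' \<otimes> c = a \<otimes> (h \<otimes> b)"
    obtain b' where b': "b' \<in> support y" "c = h \<otimes> b'" using c by (auto simp: B_def)
    have "a' \<in> carrier G" "b' \<in> carrier G" using a' b' support_subset by auto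
    then have "a' \<otimes> h \<otimes> b' = a \<otimes> h \<otimes> b" using eq ab h b' by (simp add: G.m_assoc)
    then have *: "a' = a \<and> b' = b" using unique a' b' by blast
    show "a' = a" using * by simp
    show "c = h \<otimes> b" using * b' by simp
  qed (use a b in \<open>auto simp: B_def\<close>)
  moreover have "finite B" "B \<subseteq> carrier G" using supp_y h by (auto simp: B_def)
  ultimately have "component (a \<otimes> (h \<otimes> b)) (x \<otimes>\<^bsub>R\<^esub> (z \<otimes>\<^bsub>R\<^esub> y))
      = component a x \<otimes>\<^bsub>R\<^esub> component (h \<otimes> b) (z \<otimes>\<^bsub>R\<^esub> y)"
    using supp_x x y z by (intro component_of_unique_product[where A = "support x" and B = B]) auto
  also have "\<dots> = component a x \<otimes>\<^bsub>R\<^esub> (z \<otimes>\<^bsub>R\<^esub> component b y)"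
    using component_of_homogeneous_product[OF h z(1) ab(2) y(1)] by simp
  also have "\<dots> \<noteq> \<zero>\<^bsub>R\<^esub>"
  proof (rule homogeneous_mult_nonzero[OF dom ab(1) G.m_closed[OF h ab(2)]])
    show "component a x \<in> C a" "component a x \<noteq> \<zero>\<^bsub>R\<^esub>"
      using a ab x by (auto simp: component_mem support_def)
    show "z \<otimes>\<^bsub>R\<^esub> component b y \<in> C (h \<otimes> b)"
      using component_mult[OF h ab(2) z(1)] component_mem y ab by blast
    show "z \<otimes>\<^bsub>R\<^esub> component b y \<noteq> \<zero>\<^bsub>R\<^esub>"
      using R.Units_l_cancel[of z "component b y" "\<zero>\<^bsub>R\<^esub>"] z y b component_closed
      by (auto simp: support_def)
  qed
  finally have "x \<otimes>\<^bsub>R\<^esub> z \<otimes>\<^bsub>R\<^esub> y \<noteq> \<zero>\<^bsub>R\<^esub>"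
    using x y z by (auto simp: R.m_assoc component_zero)
  then show ?thesis using z by blast
qed

text \<open>
  A zero divisor in a prime ring produces a nonzero \<open>c\<close> with \<open>c \<otimes> c = \<zero>\<close>, and then
  \<open>\<one> \<oplus> c\<close> is a unit with inverse \<open>\<one> \<ominus> c\<close>.  If it were homogeneous of trivial
  degree, then so would be \<open>c\<close>, against the hypothesis on the identity component.  If
  it had another degree \<open>g\<close>, then \<open>(u \<ominus> \<one>) \<otimes> (u \<ominus> \<one>) = \<zero>\<close> would have the component \<open>\<one>\<close> in trivial
  degree, because neither \<open>g\<close> nor \<open>g \<otimes> g\<close> is trivial.
\<close>

theorem domain_of_units_homogeneous:
  assumes tf: "torsion_free G" and dom: "noncomm_domain (R\<lparr>carrier := C \<one>\<rparr>)"
    and units: "\<And>u. u \<in> Units R \<Longrightarrow> homogeneous G R C u"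
  shows "noncomm_domain R"
proof
  have one: "\<one>\<^bsub>R\<^esub> \<noteq> \<zero>\<^bsub>R\<^esub>" by (rule one_neq_zero[OF dom])
  then show "carrier R \<noteq> {\<zero>\<^bsub>R\<^esub>}" by auto
  fix x y assume xy: "x \<in> carrier R" "y \<in> carrier R" "x \<noteq> \<zero>\<^bsub>R\<^esub>" "y \<noteq> \<zero>\<^bsub>R\<^esub>"
  show "x \<otimes>\<^bsub>R\<^esub> y \<noteq> \<zero>\<^bsub>R\<^esub>"
  proof
    assume zero: "x \<otimes>\<^bsub>R\<^esub> y = \<zero>\<^bsub>R\<^esub>"
    obtain z where z: "z \<in> carrier R" and ne: "y \<otimes>\<^bsub>R\<^esub> z \<otimes>\<^bsub>R\<^esub> x \<noteq> \<zero>\<^bsub>R\<^esub>"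
      using torsion_free_imp_prime[OF tf dom xy(2,4,1,3)] by blast
    define c where "c = y \<otimes>\<^bsub>R\<^esub> z \<otimes>\<^bsub>R\<^esub> x"
    have c: "c \<in> carrier R" using xy z by (simp add: c_def)
    have "c \<otimes>\<^bsub>R\<^esub> c = y \<otimes>\<^bsub>R\<^esub> z \<otimes>\<^bsub>R\<^esub> (x \<otimes>\<^bsub>R\<^esub> y) \<otimes>\<^bsub>R\<^esub> z \<otimes>\<^bsub>R\<^esub> x"
      using xy z by (simp add: c_def R.m_assoc)
    then have cc: "c \<otimes>\<^bsub>R\<^esub> c = \<zero>\<^bsub>R\<^esub>" using zero xy z by simp
    define u where "u = \<one>\<^bsub>R\<^esub> \<oplus>\<^bsub>R\<^esub> c"
    have u_car: "u \<in> carrier R" using c by (simp add: u_def)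
    have "u \<otimes>\<^bsub>R\<^esub> (\<one>\<^bsub>R\<^esub> \<ominus>\<^bsub>R\<^esub> c) = \<one>\<^bsub>R\<^esub>" "(\<one>\<^bsub>R\<^esub> \<ominus>\<^bsub>R\<^esub> c) \<otimes>\<^bsub>R\<^esub> u = \<one>\<^bsub>R\<^esub>"
      using c cc unfolding u_def
      by (simp_all add: R.minus_eq R.l_distr R.r_distr R.l_minus R.r_minus R.r_neg R.l_neg R.a_assoc)
    then have "u \<in> Units R" using c u_car unfolding Units_def by auto
    then obtain g where g: "g \<in> carrier G" and ug: "u \<in> C g"
      using units by (auto simp: homogeneous_def)
    show False
    proof (cases "g = \<one>")
      case True
      have "c = u \<ominus>\<^bsub>R\<^esub> \<one>\<^bsub>R\<^esub>"
        using c by (simp add: u_def R.minus_eq R.a_ac R.r_neg R.r_neg1 R.r_neg2)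
      moreover have "u \<ominus>\<^bsub>R\<^esub> \<one>\<^bsub>R\<^esub> \<in> C \<one>"
        using ug one_mem_C True component_subgroup[OF G.one_closed]
        by (simp add: R.minus_eq additive_subgroup.a_closed additive_subgroup.a_inv_closed)
      ultimately have "c \<otimes>\<^bsub>R\<^esub> c \<noteq> \<zero>\<^bsub>R\<^esub>"
        using homogeneous_mult_nonzero[OF dom G.one_closed G.one_closed] ne by (simp add: c_def)
      then show False using cc by simp
    next
      case False
      have "g \<otimes> g \<noteq> \<one>"
        using G.torsion_freeD[OF tf g, of 2] False g by (auto simp: numeral_2_eq_2)
      \<comment> \<open>This is \<open>c \<otimes> c = \<zero>\<close> in terms of \<open>u\<close>, arranged so that no subtraction occurs.\<close>
      have "u \<otimes>\<^bsub>R\<^esub> u \<oplus>\<^bsub>R\<^esub> \<one>\<^bsub>R\<^esub> = u \<oplus>\<^bsub>R\<^esub> u"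
        using c cc by (simp add: u_def R.l_distr R.r_distr R.a_ac)
      then have "component \<one> (u \<otimes>\<^bsub>R\<^esub> u) \<oplus>\<^bsub>R\<^esub> component \<one> \<one>\<^bsub>R\<^esub>
          = component \<one> u \<oplus>\<^bsub>R\<^esub> component \<one> u"
        using u_car by (simp flip: component_add)
      moreover have "component \<one> (u \<otimes>\<^bsub>R\<^esub> u) = \<zero>\<^bsub>R\<^esub>"
        using component_homogeneous[OF _ component_mult[OF g g ug ug], of \<one>] g \<open>g \<otimes> g \<noteq> \<one>\<close>
        by auto
      moreover have "component \<one> u = \<zero>\<^bsub>R\<^esub>"
        using component_homogeneous[OF g ug, of \<one>] False by auto
      moreover have "component \<one> \<one>\<^bsub>R\<^esub> = \<one>\<^bsub>R\<^esub>"
        using component_homogeneous[OF G.one_closed one_mem_C] by simp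
      ultimately show False using one by simp
    qed
  qed
qed

end

section \<open>Restricting and coarsening the grading\<close>

lemma (in monoid) Units_restrict_iff:
  assumes "H \<subseteq> carrier G"
  shows "u \<in> Units (G\<lparr>carrier := H\<rparr>) \<longleftrightarrow> u \<in> Units G \<and> u \<in> H \<and> inv u \<in> H"
proof
  assume "u \<in> Units (G\<lparr>carrier := H\<rparr>)"
  then obtain v where uv: "u \<in> H" "v \<in> H" "v \<otimes> u = \<one>" "u \<otimes> v = \<one>"
    by (auto simp: Units_def)
  then have car: "u \<in> carrier G" "v \<in> carrier G" using assms by auto
  then have "inv u = v" using uv by (intro inv_char)
  then show "u \<in> Units G \<and> u \<in> H \<and> inv u \<in> H" using uv car by (auto simp: Units_def)
next
  assume u: "u \<in> Units G \<and> u \<in> H \<and> inv u \<in> H"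
  then have "inv u \<otimes> u = \<one>" "u \<otimes> inv u = \<one>" by simp_all
  then show "u \<in> Units (G\<lparr>carrier := H\<rparr>)"
    unfolding Units_def[of "G\<lparr>carrier := H\<rparr>"]
    using u by (intro CollectI conjI bexI[of _ "inv u"]) simp_all
qed

lemma (in ring) finsum_subring:
  assumes H: "subring H R" and f: "f \<in> A \<rightarrow> H"
  shows "finsum (R\<lparr>carrier := H\<rparr>) f A = finsum R f A"
proof -
  interpret H: ring "R\<lparr>carrier := H\<rparr>" by (rule subring_is_ring[OF H])
  have "H \<subseteq> carrier R" by (rule subringE(1)[OF H])
  then show ?thesis
    using f
  proof (induction A rule: infinite_finite_induct)
    case (infinite A)
    then show ?case by (simp add: finsum_def finprod_def)
  next
    case empty
    then show ?case by (simp only: H.finsum_empty finsum_empty) simp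
  next
    case (insert a A)
    have mem: "f \<in> A \<rightarrow> H" "f a \<in> H" using insert.prems by auto
    then have "f \<in> A \<rightarrow> carrier R" "f a \<in> carrier R" using \<open>H \<subseteq> carrier R\<close> by auto
    then show ?case
      using mem insert.hyps insert.IH[OF \<open>H \<subseteq> carrier R\<close>]
      by (simp add: H.finsum_insert finsum_insert)
  qed
qed

context graded_ring
begin

text \<open>
  For a subgroup \<open>S\<close> this is the subring that \<open>S\<close> grades; for the cosets \<open>S\<close> of a normal subgroup
  these are the components of the coarser grading by the quotient group.
\<close>

definition supported :: "'g set \<Rightarrow> 'r set" where
  "supported S = {x \<in> carrier R. support x \<subseteq> S}"

lemma supportedD: "x \<in> supported S \<Longrightarrow> g \<notin> S \<Longrightarrow> component g x = \<zero>\<^bsub>R\<^esub>"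
  using component_eq_zero by (auto simp: supported_def)

lemma C_subset_supported: "g \<in> S \<Longrightarrow> g \<in> carrier G \<Longrightarrow> C g \<subseteq> supported S"
  using C_closed component_homogeneous by (fastforce simp: supported_def support_def)

lemma component_minus:
  assumes "x \<in> carrier R"
  shows "component g (\<ominus>\<^bsub>R\<^esub> x) = \<ominus>\<^bsub>R\<^esub> component g x"
proof -
  have "component g (\<ominus>\<^bsub>R\<^esub> x) \<oplus>\<^bsub>R\<^esub> component g x = component g (\<ominus>\<^bsub>R\<^esub> x \<oplus>\<^bsub>R\<^esub> x)"
    by (rule component_add[symmetric]) (use assms in auto)
  also have "\<dots> = \<zero>\<^bsub>R\<^esub>" using assms by (simp add: R.l_neg component_zero)
  finally show ?thesis
    using assms component_closed by (intro R.minus_equality[symmetric]) auto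
qed

lemma additive_subgroup_supported: "additive_subgroup (supported S) R"
proof (rule additive_subgroup.intro, rule R.add.subgroupI)
  show "supported S \<subseteq> carrier R" by (auto simp: supported_def)
  show "supported S \<noteq> {}"
    using R.zero_closed by (auto simp: supported_def support_def component_zero)
  show "\<ominus>\<^bsub>R\<^esub> x \<in> supported S" if "x \<in> supported S" for x
    using that by (auto simp: supported_def support_def component_minus)
  show "x \<oplus>\<^bsub>R\<^esub> y \<in> supported S" if "x \<in> supported S" "y \<in> supported S" for x y
  proof -
    have "x \<in> carrier R" "y \<in> carrier R" using that by (auto simp: supported_def)
    moreover have "component g (x \<oplus>\<^bsub>R\<^esub> y) = \<zero>\<^bsub>R\<^esub>" if "g \<notin> S" for g
      using supportedD[OF \<open>x \<in> supported S\<close> that] supportedD[OF \<open>y \<in> supported S\<close> that]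
        calculation by (simp add: component_add)
    ultimately show ?thesis by (auto simp: supported_def support_def)
  qed
qed

lemma supported_mult:
  assumes x: "x \<in> supported S" and y: "y \<in> supported T"
  shows "x \<otimes>\<^bsub>R\<^esub> y \<in> supported (S <#> T)"
proof -
  have car: "x \<in> carrier R" "y \<in> carrier R" using x y by (auto simp: supported_def)
  have "g \<in> S <#> T" if "g \<in> support (x \<otimes>\<^bsub>R\<^esub> y)" for g
  proof -
    have "component g (x \<otimes>\<^bsub>R\<^esub> y) \<noteq> \<zero>\<^bsub>R\<^esub>" using that by (simp add: support_def)
    then obtain a b where "a \<in> support x" "b \<in> support y" "g = a \<otimes> b"
      by (rule support_of_productE[OF car])
    then show ?thesis using x y by (auto simp: supported_def set_mult_def)
  qed
  then show ?thesis using car by (auto simp: supported_def)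
qed

lemma component_family_sum:
  assumes S: "S \<subseteq> carrier G" and f: "f \<in> fin_families R C S"
  shows "component h (family_sum R S f) = (if h \<in> S then f h else \<zero>\<^bsub>R\<^esub>)"
  unfolding family_sum_def
  by (subst component_finsum_C) (use S f in \<open>auto simp: fin_families_def\<close>)

lemma family_sum_closed:
  assumes S: "S \<subseteq> carrier G" and f: "f \<in> fin_families R C S"
  shows "family_sum R S f \<in> carrier R"
  unfolding family_sum_def
  by (rule R.finsum_closed) (use S f C_closed in \<open>auto simp: fin_families_def\<close>)

lemma family_sum_components:
  assumes S: "S \<subseteq> carrier G" and x: "x \<in> supported S"
  shows "(\<lambda>g\<in>S. component g x) \<in> fin_families R C S"
    and "family_sum R S (\<lambda>g\<in>S. component g x) = x"
proof -
  have x_car: "x \<in> carrier R" and supp: "support x \<subseteq> S" using x by (auto simp: supported_def)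
  have eq: "{g \<in> S. (\<lambda>g\<in>S. component g x) g \<noteq> \<zero>\<^bsub>R\<^esub>} = support x"
    using supp S by (auto simp: support_def)
  show fam: "(\<lambda>g\<in>S. component g x) \<in> fin_families R C S"
    unfolding fin_families_def mem_Collect_eq eq
    using x_car S finite_support by (auto simp: component_mem subset_iff)
  show "family_sum R S (\<lambda>g\<in>S. component g x) = x"
    by (rule component_eqI[OF family_sum_closed[OF S fam] x_car])
      (use supportedD[OF x] in \<open>auto simp: component_family_sum[OF S fam]\<close>)
qed

lemma carrier_graded_subring:
  assumes "S \<subseteq> carrier G"
  shows "family_sum R S ` fin_families R C S = supported S"
proof (intro subset_antisym subsetI)
  fix x assume "x \<in> family_sum R S ` fin_families R C S"
  then show "x \<in> supported S"
    using family_sum_closed[OF assms] component_family_sum[OF assms]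
    by (auto simp: supported_def support_def split: if_splits)
next
  fix x assume "x \<in> supported S"
  then show "x \<in> family_sum R S ` fin_families R C S"
    using family_sum_components[OF assms] by (metis imageI)
qed

end

context crossed_product
begin

text \<open>
  The point is that the homogeneous units with degree in \<open>N\<close> are still invertible in the subring,
  because their inverses are homogeneous with degree in \<open>N\<close>.
\<close>

theorem crossed_product_graded_subring:
  assumes N: "subgroup N G"
  shows "crossed_product (restrict_group G N) (graded_subring R C N) C"
proof -
  interpret N: subgroup N G by fact
  have RN: "graded_subring R C N = R\<lparr>carrier := supported N\<rparr>"
    by (simp add: graded_subring_def carrier_graded_subring[OF N.subset])
  have sub: "subring (supported N) R"
  proof (rule R.subringI)
    show "supported N \<subseteq> carrier R" by (auto simp: supported_def)
    show "\<one>\<^bsub>R\<^esub> \<in> supported N" using C_subset_supported[of \<one> N] one_mem_C by auto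
    show "\<ominus>\<^bsub>R\<^esub> x \<in> supported N" if "x \<in> supported N" for x
      using additive_subgroup.a_inv_closed[OF additive_subgroup_supported that] .
    show "x \<oplus>\<^bsub>R\<^esub> y \<in> supported N" if "x \<in> supported N" "y \<in> supported N" for x y
      using additive_subgroup.a_closed[OF additive_subgroup_supported that] .
    show "x \<otimes>\<^bsub>R\<^esub> y \<in> supported N" if "x \<in> supported N" "y \<in> supported N" for x y
      using supported_mult[OF that] G.subgroup_mult_id[OF N] by simp
  qed
  have fams: "fin_families (R\<lparr>carrier := supported N\<rparr>) C N = fin_families R C N"
    by (simp add: fin_families_def)
  have sums: "family_sum (R\<lparr>carrier := supported N\<rparr>) N f = family_sum R N f"
    if f: "f \<in> fin_families R C N" for f
  proof -
    have "f g \<in> supported N" if "g \<in> N" for g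
      using f that C_subset_supported[OF that] by (auto simp: fin_families_def)
    then show ?thesis
      unfolding family_sum_def by (auto intro!: R.finsum_subring[OF sub])
  qed
  show ?thesis
    unfolding RN restrict_group_def
  proof (intro crossed_product.intro graded_ring.intro graded_ring_axioms.intro
      crossed_product_axioms.intro)
    show "group (G\<lparr>carrier := N\<rparr>)" by (rule N.subgroup_is_group) (rule G.is_group)
    show "ring (R\<lparr>carrier := supported N\<rparr>)" by (rule R.subring_is_ring[OF sub])
  next
    fix g assume "g \<in> carrier (G\<lparr>carrier := N\<rparr>)"
    then have g: "g \<in> N" "g \<in> carrier G" by auto
    have "subgroup (C g) (add_monoid R\<lparr>carrier := supported N\<rparr>)"
      using component_subgroup[OF g(2)] additive_subgroup_supported[of N] C_subset_supported[OF g]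
      by (intro R.add.subgroup_incl) (auto simp: additive_subgroup_def)
    then show "additive_subgroup (C g) (R\<lparr>carrier := supported N\<rparr>)"
      by (simp add: additive_subgroup_def)
    obtain u where u: "u \<in> C g" "u \<in> Units R" "u \<in> carrier R" by (rule unit_in_component[OF g(2)])
    have "inv\<^bsub>R\<^esub> u \<in> supported N"
      using inverse_homogeneous[OF g(2) u(1,2)] C_subset_supported[of "inv g" N] g by auto
    moreover have "u \<in> supported N" using u C_subset_supported[OF g] by auto
    ultimately have "u \<in> Units (R\<lparr>carrier := supported N\<rparr>)"
      using u by (subst R.Units_restrict_iff) (auto simp: supported_def)
    then show "C g \<inter> Units (R\<lparr>carrier := supported N\<rparr>) \<noteq> {}" using u by blast
  next
    fix g h x y
    assume "g \<in> carrier (G\<lparr>carrier := N\<rparr>)" "h \<in> carrier (G\<lparr>carrier := N\<rparr>)" "x \<in> C g" "y \<in> C h"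
    then show "x \<otimes>\<^bsub>R\<lparr>carrier := supported N\<rparr>\<^esub> y \<in> C (g \<otimes>\<^bsub>G\<lparr>carrier := N\<rparr>\<^esub> h)"
      using component_mult by simp
  next
    fix x assume "x \<in> carrier (R\<lparr>carrier := supported N\<rparr>)"
    then have x: "x \<in> supported N" by simp
    have "\<exists>!f. f \<in> fin_families R C N \<and> x = family_sum R N f"
    proof (rule ex_ex1I)
      show "\<exists>f. f \<in> fin_families R C N \<and> x = family_sum R N f"
        using family_sum_components[OF N.subset x] by metis
    next
      fix f f'
      assume f: "f \<in> fin_families R C N \<and> x = family_sum R N f"
        and f': "f' \<in> fin_families R C N \<and> x = family_sum R N f'"
      have "f g = f' g" if "g \<in> N" for g
        using component_family_sum[OF N.subset, of f g] component_family_sum[OF N.subset, of f' g]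
          f f' that by simp
      then show "f = f'"
        using f f' by (intro PiE_ext[of f N C f']) (auto simp: fin_families_def)
    qed
    then show "\<exists>!f. f \<in> fin_families (R\<lparr>carrier := supported N\<rparr>) C (carrier (G\<lparr>carrier := N\<rparr>))
        \<and> x = family_sum (R\<lparr>carrier := supported N\<rparr>) (carrier (G\<lparr>carrier := N\<rparr>)) f"
      using sums by (simp add: fams cong: conj_cong)
  qed
qed

text \<open>
  Grouping the components of \<open>x\<close> by cosets decomposes it for the coarser grading.  Conversely, a
  component of degree \<open>h\<close> of a sum over cosets comes from the coset of \<open>h\<close> alone (\<open>component_sum\<close>),
  so the summands are determined by \<open>x\<close>.
\<close>

theorem crossed_product_factor_group:
  assumes N: "N \<lhd> G"
  shows "crossed_product (G Mod N) R supported"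
proof -
  interpret N: normal N G by fact
  have coset_of: "Q = N #> h" if "Q \<in> rcosets N" "h \<in> Q" for Q h
  proof -
    obtain a where "a \<in> carrier G" "Q = N #> a" using \<open>Q \<in> rcosets N\<close> by (auto simp: RCOSETS_def)
    then show ?thesis using G.repr_independence[of h N a] that N.subgroup_axioms by simp
  qed
  have coset_mem: "N #> h \<in> rcosets N" "h \<in> N #> h" if "h \<in> carrier G" for h
    using that G.rcosetsI[OF N.subset] G.rcos_self[OF _ N.subgroup_axioms] by auto
  have component_sum: "component h (family_sum R (rcosets N) F) = component h (F (N #> h))"
    if F: "F \<in> fin_families R supported (rcosets N)" and h: "h \<in> carrier G" for F h
  proof -
    define K where "K = {Q \<in> rcosets N. F Q \<noteq> \<zero>\<^bsub>R\<^esub>}"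
    have K: "finite K" using F by (simp add: K_def fin_families_def)
    have F_mem: "F Q \<in> supported Q" "F Q \<in> carrier R" if "Q \<in> rcosets N" for Q
      using F that by (auto simp: fin_families_def supported_def)
    have "component h (family_sum R (rcosets N) F) = (\<Oplus>\<^bsub>R\<^esub>Q\<in>K. component h (F Q))"
      unfolding family_sum_def K_def[symmetric]
      using K F_mem by (intro component_finsum) (auto simp: K_def)
    also have "\<dots> = (\<Oplus>\<^bsub>R\<^esub>Q\<in>K. if Q = N #> h then component h (F Q) else \<zero>\<^bsub>R\<^esub>)"
    proof (rule R.add.finprod_cong')
      fix Q assume "Q \<in> K"
      then show "component h (F Q) = (if Q = N #> h then component h (F Q) else \<zero>\<^bsub>R\<^esub>)"
        using coset_of[of Q h] supportedD[OF F_mem(1), of Q h] by (auto simp: K_def)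
    qed (use F_mem component_closed in \<open>auto simp: K_def\<close>)
    also have "\<dots> = component h (F (N #> h))"
    proof (cases "N #> h \<in> K")
      case True
      then show ?thesis
        using K F_mem component_closed
        by (intro R.add.finprod_singleton_swap) (auto simp: K_def)
    next
      case False
      then have "F (N #> h) = \<zero>\<^bsub>R\<^esub>" using coset_mem[OF h] by (simp add: K_def)
      moreover have "(\<Oplus>\<^bsub>R\<^esub>Q\<in>K. if Q = N #> h then component h (F Q) else \<zero>\<^bsub>R\<^esub>) = \<zero>\<^bsub>R\<^esub>"
        using False by (intro R.add.finprod_one_eqI) auto
      ultimately show ?thesis by (simp add: component_zero)
    qed
    finally show ?thesis .
  qed
  show ?thesis
  proof (intro crossed_product.intro graded_ring.intro graded_ring_axioms.intro
      crossed_product_axioms.intro)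
    show "group (G Mod N)" by (rule N.factorgroup_is_group)
    show "ring R" by (rule R.ring_axioms)
    show "additive_subgroup (supported Q) R" for Q by (rule additive_subgroup_supported)
    show "x \<otimes>\<^bsub>R\<^esub> y \<in> supported (P \<otimes>\<^bsub>G Mod N\<^esub> Q)"
      if "x \<in> supported P" "y \<in> supported Q" for P Q x y
      using supported_mult[OF that] by simp
  next
    fix Q assume "Q \<in> carrier (G Mod N)"
    then obtain g where g: "g \<in> carrier G" "Q = N #> g" by (auto simp: FactGroup_def RCOSETS_def)
    obtain u where "u \<in> C g" "u \<in> Units R" by (rule unit_in_component[OF g(1)])
    then show "supported Q \<inter> Units R \<noteq> {}"
      using C_subset_supported[of g Q] g coset_mem(2)[OF g(1)] by auto
  next
    fix x assume x: "x \<in> carrier R"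
    define F where "F = (\<lambda>Q\<in>rcosets N. \<Oplus>\<^bsub>R\<^esub>g\<in>Q \<inter> support x. component g x)"
    have component_F: "component h (F Q) = (if h \<in> Q then component h x else \<zero>\<^bsub>R\<^esub>)"
      if "Q \<in> rcosets N" for Q h
    proof -
      have "component h (F Q) = (if h \<in> Q \<inter> support x then component h x else \<zero>\<^bsub>R\<^esub>)"
        unfolding F_def restrict_apply'[OF that]
        by (rule component_finsum_C)
          (use x finite_support support_subset in \<open>auto intro!: component_mem\<close>)
      then show ?thesis using component_eq_zero by auto
    qed
    have F_mem: "F Q \<in> supported Q" if "Q \<in> rcosets N" for Q
    proof -
      have "F Q \<in> carrier R"
        using that x component_closed by (auto simp: F_def intro: R.finsum_closed)
      then show ?thesis using component_F[OF that] by (auto simp: supported_def support_def)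
    qed
    have "{Q \<in> rcosets N. F Q \<noteq> \<zero>\<^bsub>R\<^esub>} \<subseteq> (\<lambda>g. N #> g) ` support x"
    proof
      fix Q assume "Q \<in> {Q \<in> rcosets N. F Q \<noteq> \<zero>\<^bsub>R\<^esub>}"
      then have Q: "Q \<in> rcosets N" "F Q \<noteq> \<zero>\<^bsub>R\<^esub>" by auto
      then have "Q \<inter> support x \<noteq> {}" by (auto simp: F_def)
      then obtain g where g: "g \<in> Q" "g \<in> support x" by blast
      then show "Q \<in> (\<lambda>g. N #> g) ` support x" using coset_of[OF Q(1) g(1)] by blast
    qed
    then have "finite {Q \<in> rcosets N. F Q \<noteq> \<zero>\<^bsub>R\<^esub>}"
      using finite_support[OF x] finite_surj by blast
    then have F: "F \<in> fin_families R supported (rcosets N)"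
      using F_mem by (auto simp: fin_families_def F_def)
    have sum_closed: "family_sum R (rcosets N) F' \<in> carrier R"
      if "F' \<in> fin_families R supported (rcosets N)" for F'
      unfolding family_sum_def
      using that by (intro R.finsum_closed) (auto simp: fin_families_def supported_def)
    have "x = family_sum R (rcosets N) F"
      by (rule component_eqI[OF x sum_closed[OF F]])
        (simp add: component_sum[OF F] component_F coset_mem)
    moreover have "F1 = F2"
      if F1: "F1 \<in> fin_families R supported (rcosets N) \<and> x = family_sum R (rcosets N) F1"
        and F2: "F2 \<in> fin_families R supported (rcosets N) \<and> x = family_sum R (rcosets N) F2" for F1 F2
    proof -
      have mems: "F1 Q \<in> supported Q" "F2 Q \<in> supported Q" if "Q \<in> rcosets N" for Q
        using F1 F2 that by (auto simp: fin_families_def)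
      have "F1 Q = F2 Q" if Q: "Q \<in> rcosets N" for Q
      proof (rule component_eqI)
        show "F1 Q \<in> carrier R" "F2 Q \<in> carrier R"
          using mems[OF Q] by (auto simp: supported_def)
        fix h assume h: "h \<in> carrier G"
        show "component h (F1 Q) = component h (F2 Q)"
        proof (cases "h \<in> Q")
          case True
          have "component h (F1 (N #> h)) = component h (F2 (N #> h))"
            using component_sum[of F1 h] component_sum[of F2 h] F1 F2 h by simp
          then show ?thesis by (simp add: coset_of[OF Q True])
        next
          case False
          then show ?thesis using supportedD mems[OF Q] by simp
        qed
      qed
      then show ?thesis
        using F1 F2 by (intro PiE_ext[of F1 "rcosets N" supported F2]) (auto simp: fin_families_def)
    qed
    ultimately have "\<exists>!F. F \<in> fin_families R supported (rcosets N) \<and> x = family_sum R (rcosets N) F"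
      using F by (intro ex_ex1I) blast+
    then show "\<exists>!F. F \<in> fin_families R supported (carrier (G Mod N))
        \<and> x = family_sum R (carrier (G Mod N)) F"
      by (simp add: FactGroup_def)
  qed
qed

end

section \<open>Units of a crossed product\<close>

theorem proposition7p5:
  fixes G :: "('g, 'm) monoid_scheme" and R :: "('r, 'k) ring_scheme"
    and C :: "'g \<Rightarrow> 'r set" and N :: "'g set"
  assumes "crossed_product G R C"
    and "N \<lhd> G"
    and "torsion_free (restrict_group G N)"
    and "unique_product_group (G Mod N)"
    and "noncomm_domain (R\<lparr>carrier := C \<one>\<^bsub>G\<^esub>\<rparr>)"
  shows "(\<forall>u\<in>Units R. homogeneous G R C u) \<longleftrightarrow>
    (\<forall>u\<in>Units (graded_subring R C N).
      homogeneous (restrict_group G N) (graded_subring R C N) C u)"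
proof -
  interpret crossed_product G R C by fact
  interpret N: normal N G by fact
  interpret Q: crossed_product "G Mod N" R supported
    by (rule crossed_product_factor_group[OF assms(2)])
  interpret S: crossed_product "restrict_group G N" "graded_subring R C N" C
    by (rule crossed_product_graded_subring[OF N.subgroup_axioms])
  have RN: "graded_subring R C N = R\<lparr>carrier := supported N\<rparr>"
    by (simp add: graded_subring_def carrier_graded_subring[OF N.subset])
  have Units_RN: "u \<in> Units (graded_subring R C N) \<longleftrightarrow>
      u \<in> Units R \<and> u \<in> supported N \<and> inv\<^bsub>R\<^esub> u \<in> supported N" for u
    unfolding RN by (rule R.Units_restrict_iff) (auto simp: supported_def)
  show ?thesis
  proof (intro iffI ballI)
    fix u assume all: "\<forall>u\<in>Units R. homogeneous G R C u" and "u \<in> Units (graded_subring R C N)"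
    then have u: "u \<in> Units R" "u \<in> supported N" by (auto simp: Units_RN)
    then obtain g where g: "g \<in> carrier G" and ug: "u \<in> C g" and nz: "u \<noteq> \<zero>\<^bsub>R\<^esub>"
      using all by (auto simp: homogeneous_def)
    have "g \<in> N"
      using supportedD[OF u(2), of g] component_homogeneous[OF g ug, of g] nz by auto
    then show "homogeneous (restrict_group G N) (graded_subring R C N) C u"
      using ug nz by (auto simp: homogeneous_def restrict_group_def RN)
  next
    fix u assume all: "\<forall>u\<in>Units (graded_subring R C N).
        homogeneous (restrict_group G N) (graded_subring R C N) C u"
      and u: "u \<in> Units R"
    have "noncomm_domain (graded_subring R C N\<lparr>carrier := C \<one>\<^bsub>restrict_group G N\<^esub>\<rparr>)"
      using assms(5) by (simp add: graded_subring_def restrict_group_def)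
    then have "noncomm_domain (graded_subring R C N)"
      using S.domain_of_units_homogeneous[OF assms(3)] all by blast
    then have "noncomm_domain (R\<lparr>carrier := supported \<one>\<^bsub>G Mod N\<^esub>\<rparr>)" by (simp add: RN)
    then have "homogeneous (G Mod N) R supported u"
      using Q.units_homogeneous_of_unique_product[OF assms(4)] u by blast
    then obtain g where g: "g \<in> carrier G" and ug: "u \<in> supported (N #>\<^bsub>G\<^esub> g)" and nz: "u \<noteq> \<zero>\<^bsub>R\<^esub>"
      by (auto simp: homogeneous_def FactGroup_def RCOSETS_def)
    obtain w where w: "w \<in> C (inv\<^bsub>G\<^esub> g)" "w \<in> Units R" "w \<in> carrier R"
      by (rule unit_in_component[OF G.inv_closed[OF g]])
    have uw: "u \<otimes>\<^bsub>R\<^esub> w \<in> Units R" using u w by simp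
    \<comment> \<open>Multiplication by \<open>w\<close> moves the coset that supports \<open>u\<close> to \<open>N\<close>.\<close>
    have "(N #>\<^bsub>G\<^esub> g) <#>\<^bsub>G\<^esub> {inv\<^bsub>G\<^esub> g} = N"
      using g N.subset by (simp add: G.coset_mult_assoc G.coset_mult_one flip: r_coset_eq_set_mult)
    then have uwN: "u \<otimes>\<^bsub>R\<^esub> w \<in> supported N"
      using supported_mult[OF ug, of w "{inv\<^bsub>G\<^esub> g}"] C_subset_supported[of "inv\<^bsub>G\<^esub> g" "{inv\<^bsub>G\<^esub> g}"] w g
      by auto
    have "inv\<^bsub>R\<^esub> (u \<otimes>\<^bsub>R\<^esub> w) \<in> supported N"
      using Q.inverse_homogeneous[OF Q.G.one_closed _ uw] uwN unfolding Q.G.inv_one by simp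
    then have "u \<otimes>\<^bsub>R\<^esub> w \<in> Units (graded_subring R C N)" using uw uwN by (simp add: Units_RN)
    then obtain n where n: "n \<in> N" and uwn: "u \<otimes>\<^bsub>R\<^esub> w \<in> C n"
      using all by (auto simp: homogeneous_def restrict_group_def)
    have "u \<otimes>\<^bsub>R\<^esub> w \<otimes>\<^bsub>R\<^esub> inv\<^bsub>R\<^esub> w \<in> C (n \<otimes>\<^bsub>G\<^esub> inv\<^bsub>G\<^esub> (inv\<^bsub>G\<^esub> g))"
      using component_mult[OF _ _ uwn inverse_homogeneous[OF _ w(1,2)]] n g by simp
    moreover have "u \<otimes>\<^bsub>R\<^esub> w \<otimes>\<^bsub>R\<^esub> inv\<^bsub>R\<^esub> w = u"
      using u w by (simp add: R.m_assoc R.Units_closed)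
    ultimately show "homogeneous G R C u"
      using nz n g by (auto simp: homogeneous_def)
  qed
qed

end
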